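(* Let $m\ge 1$. Odd case: let $n=2m+1$ and $\pi\in S_n$. (1) If $2\le r\le m+1$ and $\pi$ is $r$-toppleable, then $\pi$ is $(r-1)$-toppleable. (2) If $m+2\le r\le 2m$ and $\pi$ is $r$-toppleable, then $\pi$ is $(r+1)$-toppleable. (3) $\pi$ is $(m+1)$-toppleable if and only if $\pi$ is $(m+2)$-toppleable. Even case: let $n=2m$ and $\pi\in S_n$. (1) If $2\le r\le m+1$ and $\pi$ is $r$-toppleable, then $\pi$ is $(r-1)$-toppleable. (2) If $m+2\le r\le n$ and $\pi$ is $r$-toppleable, then $\pi$ is $(r+1)$-toppleable. (3) $\pi$ is $(m+1)$-toppleable if and only if $\pi$ is $(m+2)$-toppleable.
   Context: For an integer $n\ge 2$ let $L_n=\{-\lfloor (n+1)/2\rfloor,\dots,\lfloor n/2\rfloor+1\}\subset\mathbb{Z}$; position $0$ is the origin. A toppling move chooses a position $i$ holding at least two chips, chooses two chips $\alpha<\beta$ at $i$, and moves $\alpha$ to $i-1$ and $\beta$ to $i+1$; the toppling process applies such moves (arbitrary choices) until no position holds two or more chips. For $\pi\in S_n$ and $r\in[n+1]$, the initial configuration $\pi^{(r)}$ has, for $j=1,\dots,n$, one chip at position $-\lfloor (n-1)/2\rfloor+j-1$ labeled $\pi_j$ if $\pi_j<r$ and $\pi_j+1$ if $\pi_j\ge r$, plus a chip labeled $r$ at the origin. The final configuration does not depend on the choices and has at most one chip per position; reading chips left to right gives $\mathcal{T}(\pi,r)\in S_{n+1}$. $\pi$ is $r$-toppleable if $\mathcal{T}(\pi,r)$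 is the identity permutation. *)

theory Defs
  imports Main "HOL-Combinatorics.Permutations"
begin

text \<open>
  Permutations in $S_n$ are functions \<open>\<pi> :: nat \<Rightarrow> nat\<close> with \<open>\<pi> permutes {1..n}\<close>, and
  \<open>\<pi> j\<close> is the \<open>j\<close>-th entry of the one-line notation.  On \<open>int\<close>, \<open>div 2\<close> rounds down, also
  for negative numerators.
\<close>

definition left_end :: "nat \<Rightarrow> int" where
  "left_end n = - ((int n + 1) div 2)"

definition right_end :: "nat \<Rightarrow> int" where
  "right_end n = int n div 2 + 1"

definition positions :: "nat \<Rightarrow> int set" where
  "positions n = {left_end n..right_end n}"

text \<open>
  A configuration assigns to every position the set of labels of the chips there; labels are
  pairwise distinct, so sets suffice.  For convenience it is a total function on the integers.
\<close>

type_synonym config = "int \<Rightarrow> nat set"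

definition move :: "config \<Rightarrow> int \<Rightarrow> nat \<Rightarrow> nat \<Rightarrow> config" where
  "move c i \<alpha> \<beta> =
     c(i := c i - {\<alpha>, \<beta>},
       i - 1 := insert \<alpha> (c (i - 1)),
       i + 1 := insert \<beta> (c (i + 1)))"

definition toppling_step :: "nat \<Rightarrow> config \<Rightarrow> config \<Rightarrow> bool" where
  "toppling_step n c c' \<longleftrightarrow>
     (\<exists>i\<in>positions n. \<exists>\<alpha>\<in>c i. \<exists>\<beta>\<in>c i. \<alpha> < \<beta> \<and> c' = move c i \<alpha> \<beta>)"

definition stable :: "nat \<Rightarrow> config \<Rightarrow> bool" where
  "stable n c \<longleftrightarrow> (\<forall>i\<in>positions n. card (c i) < 2)"

definition initial_config :: "nat \<Rightarrow> (nat \<Rightarrow> nat) \<Rightarrow> nat \<Rightarrow> config" where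
  "initial_config n \<pi> r = (\<lambda>i.
     {if \<pi> j < r then \<pi> j else \<pi> j + 1 | j. j \<in> {1..n} \<and> i = - ((int n - 1) div 2) + int j - 1}
     \<union> (if i = 0 then {r} else {}))"

text \<open>
  The toppling process terminates and its outcome does not depend on the choices made, so the
  description below determines a configuration whenever \<open>\<pi> permutes {1..n}\<close> and
  \<open>r \<in> {1..n + 1}\<close>.
\<close>

definition final_config :: "nat \<Rightarrow> (nat \<Rightarrow> nat) \<Rightarrow> nat \<Rightarrow> config" where
  "final_config n \<pi> r =
     (THE c. (toppling_step n)\<^sup>*\<^sup>* (initial_config n \<pi> r) c \<and> stable n c)"

definition reading_word :: "nat \<Rightarrow> config \<Rightarrow> nat list" where
  "reading_word n c =
     concat (map (\<lambda>i. sorted_list_of_set (c i)) [left_end n..right_end n])"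

text \<open>
  The word of length \<open>n + 1\<close> is turned into a function on \<open>{1..n + 1}\<close>, extended by the
  identity as \<open>permutes\<close> requires.
\<close>

definition toppled_perm :: "nat \<Rightarrow> (nat \<Rightarrow> nat) \<Rightarrow> nat \<Rightarrow> (nat \<Rightarrow> nat)" where
  "toppled_perm n \<pi> r =
     (\<lambda>k. if k \<in> {1..n + 1} then reading_word n (final_config n \<pi> r) ! (k - 1) else k)"

definition toppleable :: "nat \<Rightarrow> nat \<Rightarrow> (nat \<Rightarrow> nat) \<Rightarrow> bool" where
  "toppleable n r \<pi> \<longleftrightarrow> toppled_perm n \<pi> r = id"

end

theory Submission
  imports Defs "HOL-Library.Multiset"
begin

text \<open>
  Since the outcome does not depend on the choices, topple in rounds. A round topples the origin and
  then sweeps outwards in both directions; the leftward sweep carries the smallest chip to the left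
  end and the rightward sweep the largest one to the right end. What is left is a configuration of
  the same kind, one position shorter on each side.

  The initial configurations for \<open>r\<close> and \<open>r + 1\<close> differ by exchanging the labels \<open>r\<close> and
  \<open>r + 1\<close>. Run both processes in parallel: they agree up to the exchange until the two chips topple
  together, and from then on they coincide. So it suffices to show that the two chips meet whenever
  the outcome is sorted. Two chips that never meet keep their relative order, which settles
  the case where the larger one starts on the left. The two median chips meet at the latest in the
  last round. In the remaining case, up to reflection, \<open>a + 1\<close> starts at the origin, \<open>a\<close> to its left, and
  both have to be emitted on the left. Before they meet, \<open>a + 1\<close> can only be to the right
  of the origin if every position from the origin up to it holds a chip smaller than \<open>a\<close>. This is
  impossible when \<open>a\<close> has become the minimum, so that \<open>a + 1\<close> is then at the origin or to its left
  and is swept onto \<open>a\<close>.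
\<close>

subsection \<open>Sweeps and rounds\<close>

text \<open>One outward sweep: the carried chip \<open>c\<close> meets the next chip
  \<open>l\<close>, \<open>f c l\<close> travels on and \<open>g c l\<close> is pushed back one
  position. The chip arriving at the end is \<open>foldl f c ls\<close>. The leftward sweep carries
  minima, the rightward sweep maxima.\<close>

fun kept :: "('a \<Rightarrow> 'a \<Rightarrow> 'a) \<Rightarrow> ('a \<Rightarrow> 'a \<Rightarrow> 'a) \<Rightarrow> 'a \<Rightarrow> 'a list \<Rightarrow> 'a list" where
  "kept f g c [] = []"
| "kept f g c (l # ls) = g c l # kept f g (f c l) ls"

lemma length_kept [simp]: "length (kept f g c ls) = length ls"
  by (induction ls arbitrary: c) auto

lemma kept_eq_Nil_iff [simp]: "kept f g c ls = [] \<longleftrightarrow> ls = []"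
  by (cases ls) auto

text \<open>The two directions differ only by exchanging \<open>min\<close> and \<open>max\<close>;
  this predicate lets facts about a single sweep be proved once for both.\<close>

definition sorter :: "('a::linorder \<Rightarrow> 'a \<Rightarrow> 'a) \<Rightarrow> ('a \<Rightarrow> 'a \<Rightarrow> 'a) \<Rightarrow> bool" where
  "sorter f g \<longleftrightarrow> f = min \<and> g = max \<or> f = max \<and> g = min"

lemma sorter_min_max [simp]: "sorter min max" "sorter max min"
  by (auto simp: sorter_def)

lemma sorter_cases:
  assumes "sorter f g"
  shows "f x y = x \<and> g x y = y \<or> f x y = y \<and> g x y = x"
  using assms by (auto simp: sorter_def min_def max_def)

lemma sorter_commute:
  assumes "sorter f g"
  shows "f x y = f y x" "g x y = g y x"
  using assms by (auto simp: sorter_def min_def max_def)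

lemma mset_kept:
  assumes "sorter f g"
  shows "add_mset (foldl f c ls) (mset (kept f g c ls)) = add_mset c (mset ls)"
proof (induction ls arbitrary: c)
  case (Cons l ls)
  show ?case
    using Cons.IH[of "f c l"] sorter_cases[OF assms, of c l]
    by (auto simp: add_mset_commute)
qed auto

lemma set_kept:
  assumes "sorter f g"
  shows "insert (foldl f c ls) (set (kept f g c ls)) = insert c (set ls)"
  using arg_cong[OF mset_kept[OF assms, of c ls], of set_mset] by simp

lemma foldl_sorter_map:
  assumes "\<And>x y. f' (h x) (h y) = h (f x y)"
  shows "foldl f' (h c) (map h ls) = h (foldl f c ls)"
  by (induction ls arbitrary: c) (auto simp: assms)

lemma kept_map:
  assumes "\<And>x y. f' (h x) (h y) = h (f x y)" "\<And>x y. g' (h x) (h y) = h (g x y)"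
  shows "kept f' g' (h c) (map h ls) = map h (kept f g c ls)"
  by (induction ls arbitrary: c) (auto simp: assms)

text \<open>\<open>L\<close> and \<open>R\<close> list the chips on either side starting next to the origin, \<open>u\<close> and \<open>v\<close> are the chips at
  the origin. In \<open>kept\<close> the head is the chip pushed back to the position before the first one.\<close>

function settle :: "'a::linorder list \<Rightarrow> 'a \<Rightarrow> 'a \<Rightarrow> 'a list \<Rightarrow> 'a list" where
  "settle L u v R =
     (let kl = kept min max (min u v) L; kr = kept max min (max u v) R
      in foldl min (min u v) L #
         (if L = [] \<or> R = [] then rev kl @ kr else settle (tl kl) (hd kl) (hd kr) (tl kr)) @
         [foldl max (max u v) R])"
  by pat_completeness auto
termination
  by (relation "measure (\<lambda>(L, _, _, _). length L)") auto

declare settle.simps [simp del]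

lemma mset_settle: "mset (settle L u v R) = mset (L @ u # v # R)"
proof (induction L u v R rule: settle.induct)
  case (1 L u v R)
  let ?kl = "kept min max (min u v) L" and ?kr = "kept max min (max u v) R"
  have l: "add_mset (foldl min (min u v) L) (mset ?kl) = add_mset (min u v) (mset L)"
    by (rule mset_kept) simp
  have r: "add_mset (foldl max (max u v) R) (mset ?kr) = add_mset (max u v) (mset R)"
    by (rule mset_kept) simp
  have mid: "mset (if L = [] \<or> R = [] then rev ?kl @ ?kr else settle (tl ?kl) (hd ?kl) (hd ?kr) (tl ?kr))
      = mset ?kl + mset ?kr"
  proof (cases "L = [] \<or> R = []")
    case False
    then have "?kl \<noteq> []" "?kr \<noteq> []" by auto
    then have "add_mset (hd ?kl) (mset (tl ?kl)) = mset ?kl"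
              "add_mset (hd ?kr) (mset (tl ?kr)) = mset ?kr"
      by (metis list.exhaust_sel mset.simps(2))+
    then show ?thesis using 1[OF refl refl] False
      by (simp del: kept_eq_Nil_iff)
  qed auto
  have "mset (settle L u v R) = add_mset (foldl min (min u v) L) (mset ?kl) +
          add_mset (foldl max (max u v) R) (mset ?kr)"
    by (subst settle.simps) (simp only: Let_def mset.simps mset_append mid, simp)
  also have "\<dots> = mset (L @ u # v # R)"
    unfolding l r by (auto simp: min_def max_def)
  finally show ?case .
qed

lemma settle_commute: "settle L u v R = settle L v u R"
  by (simp add: settle.simps[of L] min.commute max.commute)

text \<open>Chips are only compared, so an order-preserving relabelling passes through every sweep.
  This carries the problem from natural to integer labels.\<close>

lemma settle_map:
  assumes "strict_mono (h :: 'a::linorder \<Rightarrow> 'b::linorder)"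
  shows "settle (map h L) (h u) (h v) (map h R) = map h (settle L u v R)"
proof (induction L u v R rule: settle.induct)
  case (1 L u v R)
  let ?kl = "kept min max (min u v) L" and ?kr = "kept max min (max u v) R"
  have mn: "\<And>x y. min (h x) (h y) = h (min x y)" and mx: "\<And>x y. max (h x) (h y) = h (max x y)"
    using strict_mono_mono[OF assms] by (simp_all add: min_of_mono max_of_mono)
  show ?case
  proof (cases "L = [] \<or> R = []")
    case True
    then show ?thesis
      by (subst (1 2) settle.simps)
         (simp only: Let_def mn mx kept_map[of min h min max max] kept_map[of max h max min min]
           foldl_sorter_map[of min h min] foldl_sorter_map[of max h max], auto simp: rev_map)
  next
    case False
    then have ne: "?kl \<noteq> []" "?kr \<noteq> []" by auto
    show ?thesis using False
      by (subst (1 2) settle.simps)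
         (simp add: Let_def mn mx kept_map[of min h min max max] kept_map[of max h max min min]
           foldl_sorter_map[of min h min] foldl_sorter_map[of max h max]
           1[OF refl refl False] hd_map[OF ne(1)] hd_map[OF ne(2)] map_tl[symmetric])
  qed
qed

text \<open>Negation exchanges \<open>min\<close> with \<open>max\<close> and hence the two sweeps.
  It will yield the case of \<open>a\<close> at the origin from that of \<open>a + 1\<close> at the
  origin.\<close>

lemma settle_reflect:
  fixes u v :: int
  shows "settle (map uminus R) (- u) (- v) (map uminus L) = rev (map uminus (settle L u v R))"
proof (induction L u v R rule: settle.induct)
  case (1 L u v R)
  let ?kl = "kept min max (min u v) L" and ?kr = "kept max min (max u v) R"
  have mn: "\<And>x y. min (- x) (- y) = - (max x y :: int)"
    and mx: "\<And>x y. max (- x) (- y) = - (min x y :: int)" by auto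
  show ?case
  proof (cases "L = [] \<or> R = []")
    case True
    then show ?thesis
      apply (subst (1 2) settle.simps)
      apply (auto simp: Let_def mn mx kept_map[of min uminus max max min] kept_map[of max uminus min min max]
           foldl_sorter_map[of min uminus max] foldl_sorter_map[of max uminus min] rev_map)
      done
  next
    case False
    then have ne: "?kl \<noteq> []" "?kr \<noteq> []" by auto
    show ?thesis using False
      apply (subst (1 2) settle.simps)
      apply (simp add: Let_def mn mx kept_map[of min uminus max max min] kept_map[of max uminus min min max]
           foldl_sorter_map[of min uminus max] foldl_sorter_map[of max uminus min]
           hd_map[OF ne(1)] hd_map[OF ne(2)] map_tl[symmetric])
      \<comment> \<open>The two chips pushed back to the origin arrive in exchanged roles.\<close>
      apply (subst settle_commute)
      apply (rule 1[OF refl refl], simp)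
      done
  qed
qed

subsection \<open>Exchanging two consecutive labels\<close>

definition before :: "'a \<Rightarrow> 'a \<Rightarrow> 'a list \<Rightarrow> bool" where
  "before p q xs \<longleftrightarrow> (\<exists>ys zs. xs = ys @ q # zs \<and> p \<in> set ys)"

lemma before_Nil [simp]: "\<not> before p q []"
  by (simp add: before_def)

lemma before_Cons [simp]: "before p q (x # xs) \<longleftrightarrow> x = p \<and> q \<in> set xs \<or> before p q xs"
proof
  assume "before p q (x # xs)"
  then obtain ys zs where *: "x # xs = ys @ q # zs" "p \<in> set ys" by (auto simp: before_def)
  then obtain y ys' where ys: "ys = y # ys'" by (cases ys) auto
  show "x = p \<and> q \<in> set xs \<or> before p q xs"
    using * ys by (auto simp: before_def)
next
  assume "x = p \<and> q \<in> set xs \<or> before p q xs"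
  then show "before p q (x # xs)"
  proof
    assume "x = p \<and> q \<in> set xs"
    then obtain ys zs where "x = p" "xs = ys @ q # zs" by (auto dest: split_list)
    then have "x # xs = (x # ys) @ q # zs \<and> p \<in> set (x # ys)" by simp
    then show ?thesis unfolding before_def by blast
  next
    assume "before p q xs"
    then obtain ys zs where "xs = ys @ q # zs" "p \<in> set ys" by (auto simp: before_def)
    then have "x # xs = (x # ys) @ q # zs \<and> p \<in> set (x # ys)" by simp
    then show ?thesis unfolding before_def by blast
  qed
qed

lemma before_append:
  "before p q (xs @ ys) \<longleftrightarrow> before p q xs \<or> before p q ys \<or> p \<in> set xs \<and> q \<in> set ys"
  by (induction xs) auto

lemma before_rev: "before p q (rev xs) \<longleftrightarrow> before q p xs"
  by (induction xs) (auto simp: before_append)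

lemma before_set: "before p q xs \<Longrightarrow> p \<in> set xs \<and> q \<in> set xs"
  by (induction xs) auto

lemma sorted_before: "sorted xs \<Longrightarrow> before p q xs \<Longrightarrow> p \<le> q"
  by (induction xs) auto

lemma before_total:
  assumes "p \<in> set xs" "q \<in> set xs" "p \<noteq> q"
  shows "before p q xs \<or> before q p xs"
  using assms by (induction xs) auto

section \<open>The exchange within a single sweep\<close>

abbreviation swap :: "int \<Rightarrow> int \<Rightarrow> int" where
  "swap a \<equiv> transpose a (a + 1)"

text \<open>No integer lies between \<open>a\<close> and \<open>a + 1\<close>, so their
  transposition preserves the order of every other pair.\<close>

lemma sorter_swap:
  assumes "sorter f g" "{x, y} \<noteq> {a, a + 1}"
  shows "f (swap a x) (swap a y) = swap a (f x y)" "g (swap a x) (swap a y) = swap a (g x y)"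
proof -
  have "\<not> (x = a \<and> y = a + 1)" "\<not> (x = a + 1 \<and> y = a)" using assms(2) by auto
  then have "swap a x \<le> swap a y \<longleftrightarrow> x \<le> y"
    unfolding transpose_def by (simp split: if_split) linarith
  then show "f (swap a x) (swap a y) = swap a (f x y)" "g (swap a x) (swap a y) = swap a (g x y)"
    using assms(1) by (auto simp: sorter_def min_def max_def)
qed

text \<open>The set equation leaves open which of the two is larger; below, \<open>p\<close> is the
  chip that a sweep reaches first.\<close>

lemma swap_pair:
  assumes "{p, q} = {a, a + 1}"
  shows "swap a p = q" "swap a q = p" "x \<noteq> p \<Longrightarrow> x \<noteq> q \<Longrightarrow> swap a x = x"
proof -
  have "p = a \<and> q = a + 1 \<or> p = a + 1 \<and> q = a"
    using assms unfolding doubleton_eq_iff .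
  then show "swap a p = q" "swap a q = p" "x \<noteq> p \<Longrightarrow> x \<noteq> q \<Longrightarrow> swap a x = x"
    by (auto simp: transpose_def)
qed

text \<open>With one of the two labels absent the critical pair is never compared, so
  \<open>sorter_swap\<close> applies to each comparison.\<close>

lemma pass_swap_single:
  assumes "sorter f g" "a \<notin> set (c # ls) \<or> a + 1 \<notin> set (c # ls)"
  shows "foldl f (swap a c) (map (swap a) ls) = swap a (foldl f c ls) \<and>
         kept f g (swap a c) (map (swap a) ls) = map (swap a) (kept f g c ls)"
  using assms(2)
proof (induction ls arbitrary: c)
  case (Cons l ls)
  have ne: "{c, l} \<noteq> {a, a + 1}" using Cons.prems by auto
  have "f c l \<in> {c, l}" using sorter_cases[OF assms(1), of c l] by auto
  then have "a \<notin> set (f c l # ls) \<or> a + 1 \<notin> set (f c l # ls)"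
    using Cons.prems by auto
  from Cons.IH[OF this] show ?case by (simp add: sorter_swap[OF assms(1) ne])
qed auto

text \<open>Either \<open>p\<close> and \<open>q\<close> are compared during the pass, in which case exchanging them has no
  effect, or \<open>p\<close> is dropped in favour of some \<open>x\<close> before \<open>q\<close> is reached.\<close>

lemma pass_swap:
  assumes "sorter f g" "{p, q} = {a, a + 1}"
    and "distinct (c # ys @ q # zs)" "p \<in> set (c # ys)" "ls = ys @ q # zs"
  shows "foldl f (swap a c) (map (swap a) ls) = foldl f c ls \<and>
           kept f g (swap a c) (map (swap a) ls) = kept f g c ls \<or>
         foldl f (swap a c) (map (swap a) ls) = swap a (foldl f c ls) \<and>
           kept f g (swap a c) (map (swap a) ls) = map (swap a) (kept f g c ls) \<and>
           before p q (kept f g c ls @ [foldl f c ls]) \<and>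
           (\<exists>x\<in>set (c # ys). x \<noteq> p \<and> f p x = x)"
  using assms(3-)
proof (induction ys arbitrary: c ls)
  case Nil
  then have [simp]: "c = p" "ls = q # zs" by auto
  have id: "map (swap a) zs = zs"
    using Nil by (intro map_idI swap_pair(3)[OF assms(2)]) auto
  show ?case
    using swap_pair(1,2)[OF assms(2)] id sorter_commute[OF assms(1), of p q] by simp
next
  case (Cons y ys)
  note f = sorter_cases[OF assms(1), of c y]
  have "q \<notin> {c, y}" using Cons.prems by auto
  then have ne: "{c, y} \<noteq> {a, a + 1}" unfolding assms(2)[symmetric] by auto
  note sw = sorter_swap[OF assms(1) ne]
  let ?r = "ys @ q # zs"
  have ls: "ls = y # ?r" using Cons.prems by simp
  have d: "distinct (f c y # ?r)" using f Cons.prems by auto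
  show ?case
  \<comment> \<open>The first comparison does not involve \<open>q\<close>. Afterwards
    \<open>p\<close> is still carried or still ahead, or it has just been dropped.\<close>
  proof (cases "p \<in> set (f c y # ys)")
    case True
    from Cons.IH[OF d True refl] show ?thesis
    proof (elim disjE, goal_cases)
      case 1
      \<comment> \<open>Both \<open>p\<close> and \<open>q\<close> are among the chips that remain,
        so the dropped chip is fixed by the exchange.\<close>
      have "swap a (g c y) = g c y"
        by (rule swap_pair(3)[OF assms(2)]) (use True f Cons.prems in auto)
      with 1 show ?case by (simp add: ls sw)
    next
      case 2
      show ?case
      proof (rule disjI2, intro conjI)
        show "foldl f (swap a c) (map (swap a) ls) = swap a (foldl f c ls)"
          using 2 by (simp add: ls sw)
        show "kept f g (swap a c) (map (swap a) ls) = map (swap a) (kept f g c ls)"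
          using 2 by (simp add: ls sw)
        show "before p q (kept f g c ls @ [foldl f c ls])"
          using 2 by (simp add: ls)
        have "set (f c y # ys) \<subseteq> set (c # y # ys)" using f by auto
        then show "\<exists>x\<in>set (c # y # ys). x \<noteq> p \<and> f p x = x" using 2 by blast
      qed
    qed
  next
    case False
    \<comment> \<open>Here \<open>p\<close> is dropped in favour of \<open>f c y\<close>. The rest
      of the sweep contains only \<open>q\<close>, which is dropped later or arrives at the
      end.\<close>
    then have p: "g c y = p" "p \<in> {c, y}" using f Cons.prems by auto
    have "a \<notin> set (f c y # ?r) \<or> a + 1 \<notin> set (f c y # ?r)"
    proof -
      have "p \<notin> set (f c y # ?r)" using False Cons.prems assms(2) by auto
      moreover have "p = a \<or> p = a + 1" using assms(2) by (metis insertI1 insertE singletonD)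
      ultimately show ?thesis by blast
    qed
    from pass_swap_single[OF assms(1) this]
    have 1: "foldl f (swap a (f c y)) (map (swap a) ?r) = swap a (foldl f (f c y) ?r)"
      "kept f g (swap a (f c y)) (map (swap a) ?r) = map (swap a) (kept f g (f c y) ?r)"
      by blast+
    have "q \<in> insert (foldl f (f c y) ?r) (set (kept f g (f c y) ?r))"
      unfolding set_kept[OF assms(1)] by simp
    then have 2: "before p q (kept f g c ls @ [foldl f c ls])"
      by (auto simp: ls p)
    have 3: "f c y \<in> set (c # y # ys)" "f c y \<noteq> p" "f p (f c y) = f c y"
      using f p False sorter_commute[OF assms(1)] Cons.prems by auto
    show ?thesis
    proof (rule disjI2, intro conjI)
      show "foldl f (swap a c) (map (swap a) ls) = swap a (foldl f c ls)"
        using 1(1) by (simp add: ls sw)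
      show "kept f g (swap a c) (map (swap a) ls) = map (swap a) (kept f g c ls)"
        using 1(2) by (simp add: ls sw)
      show "before p q (kept f g c ls @ [foldl f c ls])" by (fact 2)
      show "\<exists>x\<in>set (c # y # ys). x \<noteq> p \<and> f p x = x" using 3 by blast
    qed
  qed
qed

section \<open>The exchange within a round\<close>

abbreviation outL :: "'a::linorder list \<Rightarrow> 'a \<Rightarrow> 'a \<Rightarrow> 'a" where
  "outL L u v \<equiv> foldl min (min u v) L"

abbreviation outR :: "'a::linorder list \<Rightarrow> 'a \<Rightarrow> 'a \<Rightarrow> 'a" where
  "outR R u v \<equiv> foldl max (max u v) R"

abbreviation keptL :: "'a::linorder list \<Rightarrow> 'a \<Rightarrow> 'a \<Rightarrow> 'a list" where
  "keptL L u v \<equiv> kept min max (min u v) L"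

abbreviation keptR :: "'a::linorder list \<Rightarrow> 'a \<Rightarrow> 'a \<Rightarrow> 'a list" where
  "keptR R u v \<equiv> kept max min (max u v) R"

text \<open>A sweep over an empty side pushes nothing back, so the origin then receives at most one
  chip and the process stops. Otherwise the two heads meet at the origin and start the next
  round.\<close>

lemma settle_unfold:
  "settle L u v R = outL L u v #
     (if L = [] \<or> R = [] then rev (keptL L u v) @ keptR R u v
      else settle (tl (keptL L u v)) (hd (keptL L u v)) (hd (keptR R u v)) (tl (keptR R u v))) @
     [outR R u v]"
  by (subst settle.simps) (simp add: Let_def)

lemma settle_eqI:
  assumes "outL L u v = outL L' u' v'" "keptL L u v = keptL L' u' v'"
    and "outR R u v = outR R' u' v'" "keptR R u v = keptR R' u' v'"
  shows "settle L u v R = settle L' u' v' R'"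
proof -
  have "L = [] \<longleftrightarrow> L' = []" "R = [] \<longleftrightarrow> R' = []"
    using assms(2,4) kept_eq_Nil_iff by metis+
  then show ?thesis by (subst (1 2) settle_unfold) (simp only: assms)
qed

lemma mset_round:
  "mset (outL L u v # keptL L u v @ keptR R u v @ [outR R u v]) = mset (L @ u # v # R)"
proof -
  have "mset (outL L u v # keptL L u v @ keptR R u v @ [outR R u v]) =
    add_mset (outL L u v) (mset (keptL L u v)) + add_mset (outR R u v) (mset (keptR R u v))"
    by simp
  also have "\<dots> = mset (L @ u # v # R)"
    by (simp only: mset_kept sorter_min_max) (auto simp: min_def max_def)
  finally show ?thesis .
qed

lemma distinct_round:
  assumes "distinct (L @ u # v # R)"
  shows "distinct (outL L u v # keptL L u v @ keptR R u v @ [outR R u v])"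
  using assms mset_round[of u v L R] mset_eq_imp_distinct_iff by blast

lemma set_settle: "set (settle L u v R) = set (L @ u # v # R)"
  using mset_settle mset_eq_setD by blast

lemma set_passL: "set (keptL L u v @ [outL L u v]) = set (min u v # L)"
  using set_kept[of min max "min u v" L] by auto

lemma set_passR: "set (keptR R u v @ [outR R u v]) = set (max u v # R)"
  using set_kept[of max min "max u v" R] by auto

text \<open>\<open>outL\<close> and \<open>outR\<close> are the first and last entries of the word,
  hence extreme when it is sorted, and the part between them is sorted again. This is how sortedness
  enters the inductions over rounds.\<close>

lemma sorted_settle:
  assumes "sorted (settle L u v R)"
  shows "x \<in> set (L @ u # v # R) \<Longrightarrow> outL L u v \<le> x"
    and "x \<in> set (L @ u # v # R) \<Longrightarrow> x \<le> outR R u v"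
    and "L = [] \<or> R = [] \<Longrightarrow> sorted (rev (keptL L u v) @ keptR R u v)"
    and "\<not> (L = [] \<or> R = []) \<Longrightarrow>
      sorted (settle (tl (keptL L u v)) (hd (keptL L u v)) (hd (keptR R u v)) (tl (keptR R u v)))"
proof -
  define M where "M = (if L = [] \<or> R = [] then rev (keptL L u v) @ keptR R u v
      else settle (tl (keptL L u v)) (hd (keptL L u v)) (hd (keptR R u v)) (tl (keptR R u v)))"
  have settle: "settle L u v R = outL L u v # M @ [outR R u v]"
    unfolding M_def by (rule settle_unfold)
  show "x \<in> set (L @ u # v # R) \<Longrightarrow> outL L u v \<le> x"
    and "x \<in> set (L @ u # v # R) \<Longrightarrow> x \<le> outR R u v"
    using assms unfolding set_settle[symmetric] settle by (auto simp: sorted_append)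
  have "sorted M" using assms unfolding settle by (simp add: sorted_append)
  then show "L = [] \<or> R = [] \<Longrightarrow> sorted (rev (keptL L u v) @ keptR R u v)"
    and "\<not> (L = [] \<or> R = []) \<Longrightarrow>
      sorted (settle (tl (keptL L u v)) (hd (keptL L u v)) (hd (keptR R u v)) (tl (keptR R u v)))"
    unfolding M_def by (simp_all only: if_True if_False)
qed

text \<open>After such a round the two parallel runs still agree up to the exchange, both in the
  emitted chips and in those left behind.\<close>

definition commutes :: "int \<Rightarrow> int list \<Rightarrow> int \<Rightarrow> int \<Rightarrow> int list \<Rightarrow> bool" where
  "commutes a L u v R \<longleftrightarrow>
     outL (map (swap a) L) (swap a u) (swap a v) = swap a (outL L u v) \<and>
     keptL (map (swap a) L) (swap a u) (swap a v) = map (swap a) (keptL L u v) \<and>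
     outR (map (swap a) R) (swap a u) (swap a v) = swap a (outR R u v) \<and>
     keptR (map (swap a) R) (swap a u) (swap a v) = map (swap a) (keptR R u v)"

abbreviation settle_swap :: "int \<Rightarrow> int list \<Rightarrow> int \<Rightarrow> int \<Rightarrow> int list \<Rightarrow> int list" where
  "settle_swap a L u v R \<equiv> settle (map (swap a) L) (swap a u) (swap a v) (map (swap a) R)"

lemma settle_swap_commutes:
  assumes "commutes a L u v R"
  shows "settle_swap a L u v R = swap a (outL L u v) #
     (if L = [] \<or> R = [] then map (swap a) (rev (keptL L u v) @ keptR R u v)
      else settle_swap a (tl (keptL L u v)) (hd (keptL L u v)) (hd (keptR R u v)) (tl (keptR R u v))) @
     [swap a (outR R u v)]"
  using assms
  by (subst settle_unfold) (auto simp: commutes_def rev_map hd_map map_tl)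

text \<open>The inductive step of the meeting arguments: if the round commutes with the exchange and
  emits neither label, equality of the outcomes is inherited from the next round.\<close>

lemma settle_swap_commutes_step:
  assumes "commutes a L u v R" "L \<noteq> []" "R \<noteq> []"
    and "outL L u v \<notin> {a, a + 1}" "outR R u v \<notin> {a, a + 1}"
    and "settle_swap a (tl (keptL L u v)) (hd (keptL L u v)) (hd (keptR R u v)) (tl (keptR R u v)) =
         settle (tl (keptL L u v)) (hd (keptL L u v)) (hd (keptR R u v)) (tl (keptR R u v))"
  shows "settle_swap a L u v R = settle L u v R"
  using assms by (simp add: settle_swap_commutes settle_unfold[of L])

text \<open>The chips at the origin form an unordered pair, and no other chip is affected by the
  exchange.\<close>

lemma swap_origin:
  assumes "distinct (L @ u # v # R)" "{u, v} = {a, a + 1}"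
  shows "settle_swap a L u v R = settle L u v R"
proof -
  have "map (swap a) L = L" "map (swap a) R = R"
    using assms(1) by (auto intro!: map_idI swap_pair(3)[OF assms(2)])
  moreover have "settle L (swap a u) (swap a v) R = settle L u v R"
    using swap_pair(1,2)[OF assms(2)] settle_commute[of L u v R] by simp
  ultimately show ?thesis by simp
qed

lemma min_max_swap:
  assumes "{u, v} \<noteq> {a, a + 1}"
  shows "min (swap a u) (swap a v) = swap a (min u v)"
        "max (swap a u) (swap a v) = swap a (max u v)"
  using sorter_swap[of min max u v a] assms by auto

text \<open>After the origin topples, the left sweep acts on \<open>min u v # L\<close> and the
  right sweep on \<open>max u v # R\<close>. They share no chip and can be studied
  separately.\<close>

lemma distinct_min_max:
  assumes "distinct (L @ u # v # R)"
  shows "distinct (min u v # L)" "distinct (max u v # R)"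
    "set (min u v # L) \<inter> set (max u v # R) = {}"
  using assms by (auto simp: min_def max_def split: if_splits)

text \<open>The right sweep contains neither label and is fixed by the exchange, so
  \<open>pass_swap\<close> for the left sweep decides. The chip \<open>x\<close> that displaces
  \<open>p\<close> is recorded for later use.\<close>

lemma swap_left:
  assumes d: "distinct (L @ u # v # R)" and pq: "{p, q} = {a, a + 1}"
    and L: "L = ys @ q # zs" "p \<in> set (min u v # ys)"
  shows "settle_swap a L u v R = settle L u v R \<or>
    commutes a L u v R \<and> before p q (keptL L u v @ [outL L u v]) \<and>
      (\<exists>x\<in>set (min u v # ys). x \<noteq> p \<and> min p x = x)"
proof -
  note dm = distinct_min_max[OF d]
  have "q \<in> set L" using L by simp
  then have "q \<notin> {u, v}" using d by auto
  then have ne: "{u, v} \<noteq> {a, a + 1}" unfolding pq[symmetric] by blast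
  have "p \<notin> set (max u v # R)" "q \<notin> set (max u v # R)"
    using dm(3) L by auto
  then have no: "swap a x = x" if "x \<in> set (max u v # R)" for x
    using that by (intro swap_pair(3)[OF pq]) auto
  have R: "map (swap a) R = R" "swap a (max u v) = max u v"
    by (rule map_idI, rule no, simp) (rule no, simp)
  have R': "outR (map (swap a) R) (swap a u) (swap a v) = outR R u v"
    "keptR (map (swap a) R) (swap a u) (swap a v) = keptR R u v"
    unfolding min_max_swap(2)[OF ne] R by (rule refl)+
  have *: "swap a (outR R u v) = outR R u v" "map (swap a) (keptR R u v) = keptR R u v"
    by (rule no, use set_passR[of u v R] in auto) (rule map_idI, rule no, use set_passR[of u v R] in auto)
  have "distinct (min u v # ys @ q # zs)" using dm(1) L by simp
  from pass_swap[OF sorter_min_max(1) pq this L(2,1)] show ?thesis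
  proof
    assume "foldl min (swap a (min u v)) (map (swap a) L) = outL L u v \<and>
      kept min max (swap a (min u v)) (map (swap a) L) = keptL L u v"
    then have "settle_swap a L u v R = settle L u v R"
      by (intro settle_eqI) (simp_all only: min_max_swap[OF ne] R)
    then show ?thesis ..
  next
    assume "foldl min (swap a (min u v)) (map (swap a) L) = swap a (outL L u v) \<and>
      kept min max (swap a (min u v)) (map (swap a) L) = map (swap a) (keptL L u v) \<and>
      before p q (keptL L u v @ [outL L u v]) \<and>
      (\<exists>x\<in>set (min u v # ys). x \<noteq> p \<and> min p x = x)"
    then show ?thesis
      unfolding commutes_def R' * min_max_swap(1)[OF ne] by blast
  qed
qed

lemma swap_right:
  assumes d: "distinct (L @ u # v # R)" and pq: "{p, q} = {a, a + 1}"
    and R: "R = ys @ q # zs" "p \<in> set (max u v # ys)"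
  shows "settle_swap a L u v R = settle L u v R \<or>
    commutes a L u v R \<and> before p q (keptR R u v @ [outR R u v]) \<and>
      (\<exists>x\<in>set (max u v # ys). x \<noteq> p \<and> max p x = x)"
proof -
  note dm = distinct_min_max[OF d]
  have "q \<in> set R" using R by simp
  then have "q \<notin> {u, v}" using d by auto
  then have ne: "{u, v} \<noteq> {a, a + 1}" unfolding pq[symmetric] by blast
  have "p \<notin> set (min u v # L)" "q \<notin> set (min u v # L)"
    using dm(3) R by auto
  then have no: "swap a x = x" if "x \<in> set (min u v # L)" for x
    using that by (intro swap_pair(3)[OF pq]) auto
  have L: "map (swap a) L = L" "swap a (min u v) = min u v"
    by (rule map_idI, rule no, simp) (rule no, simp)
  have L': "outL (map (swap a) L) (swap a u) (swap a v) = outL L u v"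
    "keptL (map (swap a) L) (swap a u) (swap a v) = keptL L u v"
    unfolding min_max_swap(1)[OF ne] L by (rule refl)+
  have *: "swap a (outL L u v) = outL L u v" "map (swap a) (keptL L u v) = keptL L u v"
    by (rule no, use set_passL[of u v L] in auto) (rule map_idI, rule no, use set_passL[of u v L] in auto)
  have "distinct (max u v # ys @ q # zs)" using dm(2) R by simp
  from pass_swap[OF sorter_min_max(2) pq this R(2,1)] show ?thesis
  proof
    assume "foldl max (swap a (max u v)) (map (swap a) R) = outR R u v \<and>
      kept max min (swap a (max u v)) (map (swap a) R) = keptR R u v"
    then have "settle_swap a L u v R = settle L u v R"
      by (intro settle_eqI) (simp_all only: min_max_swap[OF ne] L)
    then show ?thesis ..
  next
    assume "foldl max (swap a (max u v)) (map (swap a) R) = swap a (outR R u v) \<and>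
      kept max min (swap a (max u v)) (map (swap a) R) = map (swap a) (keptR R u v) \<and>
      before p q (keptR R u v @ [outR R u v]) \<and>
      (\<exists>x\<in>set (max u v # ys). x \<noteq> p \<and> max p x = x)"
    then show ?thesis
      unfolding commutes_def L' * min_max_swap(2)[OF ne] by blast
  qed
qed

text \<open>Labels in different sweeps are not compared during the round, provided they do not form
  the pair at the origin.\<close>

lemma swap_split:
  assumes d: "distinct (L @ u # v # R)" and pq: "{p, q} = {a, a + 1}" "{u, v} \<noteq> {p, q}"
    and "p \<in> set (min u v # L)" "q \<in> set (max u v # R)"
  shows "commutes a L u v R"
proof -
  have ne: "{u, v} \<noteq> {a, a + 1}" using pq by simp
  note dm = distinct_min_max[OF d]
  have "p = a \<and> q = a + 1 \<or> p = a + 1 \<and> q = a"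
    using pq(1) unfolding doubleton_eq_iff .
  then have 1: "a \<notin> set (min u v # L) \<or> a + 1 \<notin> set (min u v # L)"
       and 2: "a \<notin> set (max u v # R) \<or> a + 1 \<notin> set (max u v # R)"
    using assms(4,5) dm(3) by blast+
  show ?thesis
    using pass_swap_single[OF sorter_min_max(1) 1] pass_swap_single[OF sorter_min_max(2) 2]
    by (simp add: commutes_def min_max_swap[OF ne])
qed

lemma before_ConsD:
  assumes "before p q (x # xs)"
  shows "\<exists>ys zs. xs = ys @ q # zs \<and> p \<in> set (x # ys)"
  using assms by (force simp: before_def Cons_eq_append_conv)

lemma swap_left_before:
  assumes "distinct (L @ u # v # R)" "{p, q} = {a, a + 1}"
    and "before p q (min u v # L)" "settle_swap a L u v R \<noteq> settle L u v R"
  shows "commutes a L u v R" "before p q (keptL L u v @ [outL L u v])"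
proof -
  from before_ConsD[OF assms(3)] obtain ys zs
    where sp: "L = ys @ q # zs" "p \<in> set (min u v # ys)" by blast
  show "commutes a L u v R" "before p q (keptL L u v @ [outL L u v])"
    using swap_left[OF assms(1,2) sp] assms(4) by blast+
qed

lemma swap_right_before:
  assumes "distinct (L @ u # v # R)" "{p, q} = {a, a + 1}"
    and "before p q (max u v # R)" "settle_swap a L u v R \<noteq> settle L u v R"
  shows "commutes a L u v R" "before p q (keptR R u v @ [outR R u v])"
proof -
  from before_ConsD[OF assms(3)] obtain ys zs
    where sp: "R = ys @ q # zs" "p \<in> set (max u v # ys)" by blast
  show "commutes a L u v R" "before p q (keptR R u v @ [outR R u v])"
    using swap_right[OF assms(1,2) sp] assms(4) by blast+
qed

section \<open>The larger chip on the left of the smaller one\<close>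

text \<open>Lists start next to the origin, so on the left side \<open>before q p L\<close> means
  that \<open>p\<close> is further left. Two chips sharing the origin also count as ordered.\<close>

definition left_of :: "'a \<Rightarrow> 'a \<Rightarrow> 'a list \<Rightarrow> 'a \<Rightarrow> 'a \<Rightarrow> 'a list \<Rightarrow> bool" where
  "left_of p q L u v R \<longleftrightarrow>
     before q p L \<or> p \<in> set L \<and> q \<in> insert u (insert v (set R)) \<or> {u, v} = {p, q} \<or>
     p \<in> {u, v} \<and> q \<in> set R \<or> before p q R"

lemma left_of_cases:
  fixes u v :: "'a::linorder"
  assumes "left_of p q L u v R" "{u, v} \<noteq> {p, q}"
  shows "before q p (min u v # L) \<or> p \<in> set (min u v # L) \<and> q \<in> set (max u v # R) \<or>
         before p q (max u v # R)"
  using assms by (auto simp: left_of_def min_def max_def)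

text \<open>Chips that are never compared keep their order, so without a meeting
  \<open>a + 1\<close> would precede \<open>a\<close> in the sorted outcome.\<close>

lemma settle_swap_left_of:
  assumes "distinct (L @ u # v # R)" "sorted (settle L u v R)" "left_of (a + 1) a L u v R"
  shows "settle_swap a L u v R = settle L u v R"
  using assms
proof (induction L u v R rule: settle.induct)
  case (1 L u v R)
  note d = "1.prems"(1) and s = "1.prems"(2)
  let ?kl = "keptL L u v" and ?kr = "keptR R u v" and ?e = "outL L u v" and ?e' = "outR R u v"
  note dr = distinct_round[OF d]
  show ?case
  proof (rule ccontr)
    assume neq: "settle_swap a L u v R \<noteq> settle L u v R"
    then have "{u, v} \<noteq> {a, a + 1}" using swap_origin[OF d] by blast
    then have O: "{u, v} \<noteq> {a + 1, a}" by (metis insert_commute)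
    have pq: "{a, a + 1} = {a, a + 1}" "{a + 1, a} = {a, a + 1}" by auto
    have *: "commutes a L u v R \<and> (before a (a + 1) (?kl @ [?e]) \<or>
       a + 1 \<in> set (?kl @ [?e]) \<and> a \<in> set (?kr @ [?e']) \<or> before (a + 1) a (?kr @ [?e']))"
      using left_of_cases[OF "1.prems"(3) O]
    proof (elim disjE)
      assume "before a (a + 1) (min u v # L)"
      from swap_left_before[OF d pq(1) this neq] show ?thesis by blast
    next
      assume "a + 1 \<in> set (min u v # L) \<and> a \<in> set (max u v # R)"
      then show ?thesis using swap_split[OF d pq(2) O] unfolding set_passL set_passR by blast
    next
      assume "before (a + 1) a (max u v # R)"
      from swap_right_before[OF d pq(2) this neq] show ?thesis by blast
    qed
    have "a \<in> set (L @ u # v # R)" "a + 1 \<in> set (L @ u # v # R)"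
      using "1.prems"(3) O unfolding left_of_def by (auto dest: before_set)
    \<comment> \<open>Emitted chips are extreme: \<open>a + 1\<close> cannot leave on the left, nor
      \<open>a\<close> on the right, while both are present.\<close>
    then have "?e \<le> a" "a + 1 \<le> ?e'" using sorted_settle(1,2)[OF s] by blast+
    then have e: "?e \<noteq> a + 1" "?e' \<noteq> a" by auto
    from * e have **: "before a (a + 1) ?kl \<or> a + 1 \<in> set ?kl \<and> a \<in> set ?kr \<or> before (a + 1) a ?kr"
      by (auto simp: before_append)
    then have e2: "?e \<notin> {a, a + 1}" "?e' \<notin> {a, a + 1}"
      using dr by (auto dest: before_set)
    show False
    proof (cases "L = [] \<or> R = []")
      case True
      \<comment> \<open>No round follows, so the chips left behind already stand in their final
        order, with \<open>a + 1\<close> before \<open>a\<close>.\<close>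
      then have "sorted (rev ?kl @ ?kr)" by (rule sorted_settle(3)[OF s])
      moreover have "before (a + 1) a (rev ?kl @ ?kr)"
        using ** by (auto simp: before_append before_rev)
      ultimately show False by (auto dest: sorted_before)
    next
      case False
      then obtain x xs y ys where k: "?kl = x # xs" "?kr = y # ys"
        by (metis kept_eq_Nil_iff list.exhaust)
      have "left_of (a + 1) a (tl ?kl) (hd ?kl) (hd ?kr) (tl ?kr)"
        using ** k by (auto simp: left_of_def)
      moreover have "sorted (settle (tl ?kl) (hd ?kl) (hd ?kr) (tl ?kr))"
        by (rule sorted_settle(4)[OF s False])
      moreover have "distinct (tl ?kl @ hd ?kl # hd ?kr # tl ?kr)"
        using dr k by auto
      ultimately have "settle_swap a (tl ?kl) (hd ?kl) (hd ?kr) (tl ?kr) =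
          settle (tl ?kl) (hd ?kl) (hd ?kr) (tl ?kr)"
        using "1.IH"[OF refl refl False] by blast
      with settle_swap_commutes_step[of a L u v R] * e2 False neq show False by blast
    qed
  qed
qed

section \<open>The larger chip at the origin, the smaller one to its left\<close>

text \<open>Every chip dropped before \<open>a + 1\<close> is the minimum of a pair containing a
  chip below \<open>a\<close>. The chip above \<open>a + 1\<close> ensures that \<open>a + 1\<close>
  is itself dropped rather than carried to the end. This preserves the last alternative of
  \<open>unmet\<close> below.\<close>

lemma kept_prefix_less:
  fixes a d :: int
  assumes "distinct (d # R)" "a \<notin> set (d # R)"
    and "d = a + 1 \<or> (\<exists>zs ws. R = zs @ (a + 1) # ws \<and> (\<forall>z\<in>set zs. z < a))"
    and "\<exists>w\<in>set (d # R). w > a + 1"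
  shows "\<exists>zs ws. kept max min d R = zs @ (a + 1) # ws \<and> (\<forall>z\<in>set zs. z < a)"
  using assms
proof (induction R arbitrary: d)
  case (Cons r R)
  \<comment> \<open>A comparison either drops a chip below \<open>a\<close> and passes the invariant
    to the rest of the sweep (\<open>step\<close>), or drops \<open>a + 1\<close> and leaves an
    empty prefix (\<open>stop\<close>).\<close>
  have step: ?case
    if "min d r < a" and 1: "max d r = a + 1 \<or> (\<exists>zs ws. R = zs @ (a + 1) # ws \<and> (\<forall>z\<in>set zs. z < a))"
  proof -
    have 2: "distinct (max d r # R)" "a \<notin> set (max d r # R)"
      using Cons.prems(1,2) by (auto simp: max_def)
    have 3: "\<exists>w\<in>set (max d r # R). w > a + 1"
      using Cons.prems(4) that(1) by (auto simp: max_def min_def split: if_splits)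
    obtain zs ws where "kept max min (max d r) R = zs @ (a + 1) # ws" "\<forall>z\<in>set zs. z < a"
      using Cons.IH[OF 2 1 3] by blast
    then have "kept max min d (r # R) = (min d r # zs) @ (a + 1) # ws \<and>
        (\<forall>z\<in>set (min d r # zs). z < a)"
      using that by simp
    then show ?thesis by blast
  qed
  have stop: ?case if "min d r = a + 1"
  proof -
    have "kept max min d (r # R) = [] @ (a + 1) # kept max min (max d r) R" using that by simp
    then show ?thesis by (metis empty_iff empty_set)
  qed
  show ?case
  proof (cases "d = a + 1")
    case True
    then have "r < a \<or> r > a + 1" using Cons.prems(1,2) by force
    then show ?thesis using step stop True by auto
  next
    case False
    then obtain zs ws where R: "r # R = zs @ (a + 1) # ws" "\<forall>z\<in>set zs. z < a"
      using Cons.prems(3) by blast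
    show ?thesis
    proof (cases zs)
      case Nil
      then have "d < a \<or> d > a + 1" "r = a + 1" using Cons.prems(1,2) R by force+
      then show ?thesis using step stop by auto
    next
      case (Cons z zs')
      with R have "r < a" "R = zs' @ (a + 1) # ws" "\<forall>z\<in>set zs'. z < a" by auto
      then show ?thesis using step by (metis min.strict_coboundedI2)
    qed
  qed
qed auto

text \<open>The possible situations, as long as \<open>a\<close> and \<open>a + 1\<close> have not been compared, when \<open>a + 1\<close>
  starts at the origin and \<open>a\<close> to the left of it.\<close>

definition unmet :: "int \<Rightarrow> int list \<Rightarrow> int \<Rightarrow> int \<Rightarrow> int list \<Rightarrow> bool" where
  "unmet a L u v R \<longleftrightarrow>
     before (a + 1) a L \<or> a \<in> set L \<and> a + 1 \<in> {u, v} \<or> {u, v} = {a, a + 1} \<or>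
     min u v < a \<and> a \<in> insert u (insert v (set L)) \<and>
       (\<exists>zs ws. R = zs @ (a + 1) # ws \<and> (\<forall>z\<in>set zs. z < a))"

text \<open>A round removes two chips: \<open>outL\<close>, which is counted, and
  \<open>outR\<close>, which is not. The count thus falls in step with the lengths of the two
  sides.\<close>

lemma card_less_round:
  assumes "distinct (L @ u # v # R)" "L \<noteq> []" "R \<noteq> []"
    and "outL L u v < b" "b \<le> outR R u v"
  shows "card {x \<in> set (L @ u # v # R). x < b} =
    Suc (card {x \<in> set (tl (keptL L u v) @ hd (keptL L u v) # hd (keptR R u v) # tl (keptR R u v)). x < b})"
    (is "card ?A = Suc (card ?B)")
proof -
  let ?kl = "keptL L u v" and ?kr = "keptR R u v"
  have "?kl \<noteq> []" "?kr \<noteq> []" using assms by auto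
  then have "set (tl ?kl @ hd ?kl # hd ?kr # tl ?kr) = set ?kl \<union> set ?kr"
    by (metis (no_types, lifting) Un_insert_left Un_insert_right list.collapse list.simps(15) set_append)
  moreover have "set (L @ u # v # R) = set (outL L u v # ?kl @ ?kr @ [outR R u v])"
    using mset_round[of u v L R] by (metis mset_eq_setD)
  ultimately have "?A = insert (outL L u v) ?B" using assms(4,5) by auto
  moreover have "outL L u v \<notin> ?B"
    using distinct_round[OF assms(1)] \<open>set (tl ?kl @ _) = _\<close> by auto
  ultimately show ?thesis by simp
qed

lemma card_split:
  fixes b :: int
  assumes "finite S" "b \<in> S"
  shows "card S = card {x \<in> S. x < b} + card {x \<in> S. x > b} + 1"
proof -
  have "S = insert b ({x \<in> S. x < b} \<union> {x \<in> S. x > b})" using assms by auto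
  then have "card S = card (insert b ({x \<in> S. x < b} \<union> {x \<in> S. x > b}))" by (rule arg_cong)
  also have "\<dots> = card ({x \<in> S. x < b} \<union> {x \<in> S. x > b}) + 1" using assms(1) by simp
  also have "card ({x \<in> S. x < b} \<union> {x \<in> S. x > b}) = card {x \<in> S. x < b} + card {x \<in> S. x > b}"
    by (rule card_Un_disjoint) (use assms(1) in auto)
  finally show ?thesis .
qed

lemma card_less_succ:
  fixes a :: int
  assumes "finite S" "a \<in> S"
  shows "card {x \<in> S. x < a + 1} = card {x \<in> S. x < a} + 1"
proof -
  have "{x \<in> S. x < a + 1} = insert a {x \<in> S. x < a}" using assms by auto
  then show ?thesis using assms(1) by simp
qed

text \<open>The chip \<open>a\<close> alone exhausts the count, so nothing lies below it.\<close>

lemma card_less_succ_le_1: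
  fixes a :: int
  assumes "finite S" "a \<in> S" "card {x \<in> S. x < a + 1} \<le> 1" "x \<in> S"
  shows "a \<le> x"
proof -
  have "card {x \<in> S. x < a} = 0" using card_less_succ[OF assms(1,2)] assms(3) by linarith
  then have "{x \<in> S. x < a} = {}" using assms(1) by simp
  then show ?thesis using assms(4) by force
qed

text \<open>At most \<open>length R\<close> chips are \<open>a\<close> or smaller, and a round
  lowers both numbers by one. If a side ran out with the pair apart, \<open>a\<close> would be
  absent or the minimum, while \<open>unmet\<close> would demand a smaller chip at the
  origin.\<close>

lemma settle_swap_unmet:
  assumes "distinct (L @ u # v # R)" "sorted (settle L u v R)" "unmet a L u v R"
    and "a + 1 \<in> set (L @ u # v # R)"
    and "length L \<le> length R + 1" "length R \<le> length L + 1"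
    and "card {x \<in> set (L @ u # v # R). x < a + 1} \<le> length R"
  shows "settle_swap a L u v R = settle L u v R"
  using assms
proof (induction L u v R rule: settle.induct)
  case (1 L u v R)
  note d = "1.prems"(1) and s = "1.prems"(2)
  let ?kl = "keptL L u v" and ?kr = "keptR R u v" and ?e = "outL L u v" and ?e' = "outR R u v"
  let ?S = "set (L @ u # v # R)"
  note dr = distinct_round[OF d] and dm = distinct_min_max[OF d]
  show ?case
  proof (rule ccontr)
    assume neq: "settle_swap a L u v R \<noteq> settle L u v R"
    then have O: "{u, v} \<noteq> {a, a + 1}" using swap_origin[OF d] by blast
    have pq: "{a, a + 1} = {a, a + 1}" "{a + 1, a} = {a, a + 1}" by auto
    have S: "?S = set (min u v # L) \<union> set (max u v # R)" by (auto simp: min_def max_def)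
    have aS: "a \<in> ?S"
      using "1.prems"(3) O by (auto simp: unmet_def dest: before_set)
    have RN: "R \<noteq> []"
    proof
      assume "R = []"
      with "1.prems"(7) have "card {x \<in> ?S. x < a + 1} = 0" by simp
      then have "{x \<in> ?S. x < a + 1} = {}" by simp
      with aS show False by (auto simp: set_eq_iff)
    qed
    \<comment> \<open>The bound leaves at least \<open>length L + 1\<close> chips above
      \<open>a + 1\<close>, so the right sweep emits one of those.\<close>
    have "card {x \<in> ?S. x < a + 1} + card {x \<in> ?S. x > a + 1} + 1 = card ?S"
      using card_split[OF finite_set "1.prems"(4)] by (rule sym)
    also have "card ?S = length L + length R + 2"
      using distinct_card[OF d] by simp
    finally have "card {x \<in> ?S. x > a + 1} > 0" using "1.prems"(7) by linarith
    then obtain w where w: "w \<in> ?S" "w > a + 1" by (metis (mono_tags, lifting) card_gt_0_iff mem_Collect_eq ex_in_conv)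
    then have e': "?e' > a + 1" using sorted_settle(2)[OF s] by force
    have "?e' \<in> set (?kr @ [?e'])" by simp
    then have e'R: "?e' \<in> set (max u v # R)" unfolding set_passR .
    have "L \<noteq> []"
    proof
      \<comment> \<open>Now \<open>length R\<close> is at most one and \<open>a\<close> is the
        minimum. With \<open>L\<close> empty and the pair not at the origin, \<open>unmet\<close>
        still requires \<open>min u v < a\<close>.\<close>
      assume L: "L = []"
      with "1.prems"(6) have "length R \<le> 1" by simp
      with "1.prems"(7) have "card {x \<in> ?S. x < a + 1} \<le> 1" by linarith
      moreover have "min u v \<in> ?S" unfolding S by simp
      ultimately have "\<not> min u v < a"
        using card_less_succ_le_1[OF finite_set aS] leD by blast
      with L "1.prems"(3) O show False by (auto simp: unmet_def)
    qed
    with RN have LR: "\<not> (L = [] \<or> R = [])" by simp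
    then obtain x xs y ys where k: "?kl = x # xs" "?kr = y # ys"
      by (metis kept_eq_Nil_iff list.exhaust)
    \<comment> \<open>If both labels are in the left sweep with \<open>a + 1\<close> first, then
      \<open>a + 1\<close> is dropped before \<open>a\<close> is reached. Otherwise \<open>a\<close>
      goes into the left sweep and \<open>a + 1\<close> into the right one, at its start or behind
      chips below \<open>a\<close>.\<close>
    have "commutes a L u v R \<and> ?e < a \<and> unmet a xs x y ys"
    proof (cases "before (a + 1) a (min u v # L)")
      case True
      then obtain ys' zs where sp: "L = ys' @ a # zs" "a + 1 \<in> set (min u v # ys')"
        using before_ConsD by metis
      from swap_left[OF d pq(2) sp] neq
      obtain z where *: "commutes a L u v R" "before (a + 1) a (?kl @ [?e])"
        "z \<in> set (min u v # ys')" "z \<noteq> a + 1" "min (a + 1) z = z" by auto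
      \<comment> \<open>The chip \<open>z\<close> that displaced \<open>a + 1\<close> differs from
        \<open>a\<close>, which lies further out, so \<open>z\<close> and with it the emitted
        minimum are below \<open>a\<close>.\<close>
      have "z \<noteq> a" using dm(1) *(3) sp by auto
      with * have "z < a" by auto
      moreover have "z \<in> ?S" using *(3) sp by (auto simp: min_def split: if_splits)
      ultimately have e: "?e < a" using sorted_settle(1)[OF s] by fastforce
      with * have "before (a + 1) a ?kl" by (auto simp: before_append)
      then have "unmet a xs x y ys" using k by (auto simp: unmet_def)
      with * e show ?thesis by simp
    next
      case False
      have "min u v < a \<and> a \<in> insert u (insert v (set L)) \<and>
        (max u v = a + 1 \<or> (\<exists>zs ws. R = zs @ (a + 1) # ws \<and> (\<forall>z\<in>set zs. z < a)))"
        using "1.prems"(3) unfolding unmet_def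
      proof (elim disjE)
        assume "a \<in> set L \<and> a + 1 \<in> {u, v}"
        then have "a \<in> set L" "min u v = a + 1 \<or> max u v = a + 1"
          by (auto simp: min_def max_def)
        with False have m: "max u v = a + 1" by auto
        moreover have "min u v \<noteq> a" using dm(1) \<open>a \<in> set L\<close> by auto
        moreover have "min u v \<noteq> max u v" using dm(3) by auto
        ultimately have "min u v < a" by linarith
        with m \<open>a \<in> set L\<close> show ?thesis by simp
      next
        assume "before (a + 1) a L"
        with False show ?thesis by simp
      next
        assume "{u, v} = {a, a + 1}"
        with O show ?thesis by contradiction
      qed blast
      then have c: "min u v < a" "a \<in> insert u (insert v (set L))"
        "max u v = a + 1 \<or> (\<exists>zs ws. R = zs @ (a + 1) # ws \<and> (\<forall>z\<in>set zs. z < a))"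
        by blast+
      \<comment> \<open>If \<open>a\<close> went right, it would be carried past the smaller chips
        \<open>zs\<close> and meet \<open>a + 1\<close>, contrary to \<open>neq\<close>.\<close>
      have ed: "max u v \<noteq> a"
      proof
        assume m: "max u v = a"
        then obtain zs ws where R: "R = zs @ (a + 1) # ws" "\<forall>z\<in>set zs. z < a"
          using c(3) by fastforce
        have "a \<in> set (max u v # zs)" using m by simp
        from swap_right[OF d pq(1) R(1) this] neq
        obtain z where "z \<in> set (max u v # zs)" "z \<noteq> a" "max a z = z" by blast
        with m R(2) show False by (auto simp: max_def split: if_splits)
      qed
      with c(1,2) have aL: "a \<in> set L" by (auto simp: min_def max_def split: if_splits)
      have aR: "a \<notin> set (max u v # R)" using aL dm(3) by auto
      have "\<exists>w\<in>set (max u v # R). w > a + 1" using e' e'R by blast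
      from kept_prefix_less[OF dm(2) aR c(3) this]
      obtain zs ws where kr: "?kr = zs @ (a + 1) # ws" "\<forall>z\<in>set zs. z < a" by blast
      have "?e \<le> min u v" using sorted_settle(1)[OF s, of "min u v"] unfolding S by simp
      with c(1) have e: "?e < a" by (rule le_less_trans[rotated])
      have "a \<in> set (?kl @ [?e])" unfolding set_passL using aL by simp
      with e have akl: "a \<in> set ?kl" by auto
      have "a + 1 \<in> set (?kr @ [?e'])" using kr by simp
      then have "a + 1 \<in> set (max u v # R)" unfolding set_passR .
      with swap_split[OF d pq(1) O] aL have com: "commutes a L u v R" by simp
      \<comment> \<open>With an empty prefix, \<open>a + 1\<close> is pushed back to the origin;
        otherwise a chip below \<open>a\<close> is, and the last alternative of \<open>unmet\<close>
        persists.\<close>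
      have "unmet a xs x y ys"
      proof (cases zs)
        case Nil
        then show ?thesis using kr akl k by (auto simp: unmet_def)
      next
        case (Cons z zs')
        then show ?thesis using kr akl k by (auto simp: unmet_def)
      qed
      with com e show ?thesis by simp
    qed
    then have com: "commutes a L u v R" and e: "?e < a" and um: "unmet a xs x y ys" by auto
    have e2: "?e \<notin> {a, a + 1}" "?e' \<notin> {a, a + 1}" using e e' by auto
    have "a + 1 \<in> set (?e # ?kl @ ?kr @ [?e'])"
      using "1.prems"(4) mset_round[of u v L R] by (metis mset_eq_setD)
    then have bS: "a + 1 \<in> set (xs @ x # y # ys)" using e e' k by auto
    have len: "length xs = length L - 1" "length ys = length R - 1"
      using k length_kept[of min max "min u v" L] length_kept[of max min "max u v" R] by auto
    have "card {z \<in> set (xs @ x # y # ys). z < a + 1} \<le> length ys"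
      using card_less_round[OF d, of "a + 1"] LR e e' k "1.prems"(7) len by simp
    moreover have "sorted (settle xs x y ys)"
      using sorted_settle(4)[OF s LR] k by simp
    moreover have "distinct (xs @ x # y # ys)" using dr k by auto
    moreover have "length xs \<le> length ys + 1" "length ys \<le> length xs + 1"
      using len "1.prems"(5,6) LR by auto
    ultimately have "settle_swap a xs x y ys = settle xs x y ys"
      using "1.IH"[OF refl refl LR] bS um k by simp
    with settle_swap_commutes_step[OF com _ _ e2] LR neq k show False by simp
  qed
qed

section \<open>The two median chips\<close>

text \<open>There are \<open>length R\<close> chips below \<open>a\<close> and
  \<open>length L\<close> above \<open>a + 1\<close>, so every round but the last emits other chips
  and keeps the pair in the middle. The last round has just the pair at the origin, or three chips
  of which the smallest leaves first.\<close>

lemma settle_swap_median: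
  assumes "distinct (L @ u # v # R)" "sorted (settle L u v R)"
    and "a \<in> set (L @ u # v # R)" "a + 1 \<in> set (L @ u # v # R)"
    and "length R = length L \<or> length R = length L + 1"
    and "card {x \<in> set (L @ u # v # R). x < a} = length R"
  shows "settle_swap a L u v R = settle L u v R"
  using assms
proof (induction L u v R rule: settle.induct)
  case (1 L u v R)
  note d = "1.prems"(1) and s = "1.prems"(2)
  let ?kl = "keptL L u v" and ?kr = "keptR R u v" and ?e = "outL L u v" and ?e' = "outR R u v"
  let ?S = "set (L @ u # v # R)"
  note dr = distinct_round[OF d] and dm = distinct_min_max[OF d]
  show ?case
  proof (rule ccontr)
    assume neq: "settle_swap a L u v R \<noteq> settle L u v R"
    then have O: "{u, v} \<noteq> {a, a + 1}" using swap_origin[OF d] by blast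
    then have O': "{u, v} \<noteq> {a + 1, a}" by (metis insert_commute)
    have pq: "{a, a + 1} = {a, a + 1}" "{a + 1, a} = {a, a + 1}" by auto
    have S: "?S = set (min u v # L) \<union> set (max u v # R)" by (auto simp: min_def max_def)
    \<comment> \<open>No relative position is prescribed here: wherever the two labels lie, they
      meet or the round commutes with the exchange.\<close>
    have com: "commutes a L u v R"
    proof -
      have "before a (a + 1) xs \<or> before (a + 1) a xs" if "a \<in> set xs" "a + 1 \<in> set xs" for xs
        using before_total[OF that] by simp
      then consider "before a (a + 1) (min u v # L)" | "before (a + 1) a (min u v # L)"
        | "before a (a + 1) (max u v # R)" | "before (a + 1) a (max u v # R)"
        | "a \<in> set (min u v # L)" "a + 1 \<in> set (max u v # R)"
        | "a + 1 \<in> set (min u v # L)" "a \<in> set (max u v # R)"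
        using "1.prems"(3,4) unfolding S by blast
      then show ?thesis
      proof cases
        case 1 from swap_left_before[OF d pq(1) this neq] show ?thesis by blast
      next
        case 2 from swap_left_before[OF d pq(2) this neq] show ?thesis by blast
      next
        case 3 from swap_right_before[OF d pq(1) this neq] show ?thesis by blast
      next
        case 4 from swap_right_before[OF d pq(2) this neq] show ?thesis by blast
      next
        case 5 then show ?thesis using swap_split[OF d pq(1) O] by blast
      next
        case 6 then show ?thesis using swap_split[OF d pq(2) O'] by blast
      qed
    qed
    have cS: "card ?S = length L + length R + 2"
      using distinct_card[OF d] by simp
    have gt: "card {x \<in> ?S. x > a + 1} = length L"
      using card_split[OF finite_set "1.prems"(4)] card_less_succ[OF finite_set "1.prems"(3)]
        cS "1.prems"(6) by linarith
    have RN: "R \<noteq> []"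
    proof
      assume R: "R = []"
      with "1.prems"(5) have L: "L = []" by simp
      with R "1.prems"(3,4) have "{u, v} = {a, a + 1}" by auto
      with O show False ..
    qed
    then have "card {x \<in> ?S. x < a} > 0" using "1.prems"(6) by simp
    then obtain w where w: "w \<in> ?S" "w < a"
      by (metis (mono_tags, lifting) card_gt_0_iff mem_Collect_eq ex_in_conv)
    then have e: "?e < a" using sorted_settle(1)[OF s] by force
    have LN: "L \<noteq> []"
    proof
      assume L: "L = []"
      \<comment> \<open>Three chips remain. \<open>min u v\<close> is below \<open>a\<close> and
        leaves on the left, so the right sweep compares \<open>a\<close> with
        \<open>a + 1\<close>.\<close>
      with RN "1.prems"(5) obtain z where R: "R = [z]" by (cases R) auto
      have "min u v < a" using e L by simp
      then have "a \<in> {max u v, z}" "a + 1 \<in> {max u v, z}"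
        using "1.prems"(3,4) unfolding S L R by auto
      with d have "max u v = a \<and> z = a + 1 \<or> max u v = a + 1 \<and> z = a" by auto
      then have mz: "{max u v, z} = {a, a + 1}" by auto
      have sw: "min (swap a u) (swap a v) = min u v" "max (swap a u) (swap a v) = swap a (max u v)"
        using min_max_swap[OF O] \<open>min u v < a\<close> by (auto simp: transpose_def)
      from mz have "max (swap a (max u v)) (swap a z) = max (max u v) z"
        "min (swap a (max u v)) (swap a z) = min (max u v) z"
        by (auto simp: doubleton_eq_iff)
      then have "settle_swap a L u v R = settle L u v R"
        by (simp add: settle_unfold L R sw)
      with neq show False ..
    qed
    then have "card {x \<in> ?S. x > a + 1} > 0" using gt by simp
    then obtain w' where w': "w' \<in> ?S" "w' > a + 1"
      by (metis (mono_tags, lifting) card_gt_0_iff mem_Collect_eq ex_in_conv)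
    then have e': "?e' > a + 1" using sorted_settle(2)[OF s] by force
    from LN RN have LR: "\<not> (L = [] \<or> R = [])" by simp
    then obtain x xs y ys where k: "?kl = x # xs" "?kr = y # ys"
      by (metis kept_eq_Nil_iff list.exhaust)
    have e2: "?e \<notin> {a, a + 1}" "?e' \<notin> {a, a + 1}" using e e' by auto
    have "?S = set (?e # ?kl @ ?kr @ [?e'])"
      using mset_round[of u v L R] by (metis mset_eq_setD)
    then have bS: "a \<in> set (xs @ x # y # ys)" "a + 1 \<in> set (xs @ x # y # ys)"
      using "1.prems"(3,4) e e' k by auto
    have len: "length xs = length L - 1" "length ys = length R - 1"
      using k length_kept[of min max "min u v" L] length_kept[of max min "max u v" R] by auto
    have "card {z \<in> set (xs @ x # y # ys). z < a} = length ys"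
      using card_less_round[OF d, of a] LR e e' k "1.prems"(6) len by simp
    moreover have "sorted (settle xs x y ys)"
      using sorted_settle(4)[OF s LR] k by simp
    moreover have "distinct (xs @ x # y # ys)" using dr k by auto
    moreover have "length ys = length xs \<or> length ys = length xs + 1"
      using len "1.prems"(5) LR by (cases L; cases R) auto
    ultimately have "settle_swap a xs x y ys = settle xs x y ys"
      using "1.IH"[OF refl refl LR] bS k by simp
    with settle_swap_commutes_step[OF com _ _ e2] LR neq k show False by simp
  qed
qed

section \<open>One chip of the pair at the origin\<close>

text \<open>If \<open>a\<close> starts on the left this is the \<open>unmet\<close> situation, at
  the origin the chips meet at once, and on the right \<open>a + 1\<close> is \<open>left_of\<close>
  \<open>a\<close>.\<close>

lemma settle_swap_origin_upper:
  fixes a :: int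
  assumes "distinct (L @ (a + 1) # v # R)" "sorted (settle L (a + 1) v R)" "a \<in> set (L @ v # R)"
    and "length L \<le> length R + 1" "length R \<le> length L + 1"
    and "card {x \<in> set (L @ (a + 1) # v # R). x < a + 1} \<le> length R"
  shows "settle_swap a L (a + 1) v R = settle L (a + 1) v R"
proof -
  consider "a \<in> set L" | "a = v" | "a \<in> set R" using assms(3) by auto
  then show ?thesis
  proof cases
    case 1
    then have "unmet a L (a + 1) v R" by (simp add: unmet_def)
    then show ?thesis by (rule settle_swap_unmet[OF assms(1,2) _ _ assms(4-6)]) simp
  next
    case 2
    then show ?thesis by (intro swap_origin[OF assms(1)]) auto
  next
    case 3
    then have "left_of (a + 1) a L (a + 1) v R" by (simp add: left_of_def)
    then show ?thesis by (rule settle_swap_left_of[OF assms(1,2)])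
  qed
qed

lemma swap_uminus: "transpose (- a - 1) (- a) (- x) = - swap a x" for a :: int
  by (auto simp: transpose_def)

text \<open>Negation turns the pair into \<open>- a - 1\<close> and \<open>- a\<close>, of which the
  larger is now at the origin, and reverses the sides.\<close>

lemma settle_swap_origin_lower:
  fixes a :: int
  assumes "distinct (L @ a # v # R)" "sorted (settle L a v R)" "a + 1 \<in> set (L @ v # R)"
    and "length L \<le> length R + 1" "length R \<le> length L + 1"
    and "card {x \<in> set (L @ a # v # R). x > a} \<le> length L"
  shows "settle_swap a L a v R = settle L a v R"
proof -
  let ?L = "map uminus R" and ?R = "map uminus L" and ?a = "- a - 1"
  let ?S = "set (L @ a # v # R)"
  have a: "?a + 1 = - a" by simp
  have S: "set (?L @ (?a + 1) # - v # ?R) = uminus ` ?S" by auto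
  have "distinct (map uminus (R @ a # v # L))"
    using assms(1) by (auto simp: distinct_map)
  then have "distinct (?L @ (?a + 1) # - v # ?R)" by simp
  moreover have "sorted (settle ?L (?a + 1) (- v) ?R)"
    unfolding a settle_reflect using assms(2) by (simp add: sorted_wrt_rev sorted_wrt_map)
  moreover have "?a \<in> set (?L @ - v # ?R)"
  proof -
    have "- (a + 1) \<in> uminus ` set (L @ v # R)" using assms(3) by (rule imageI)
    then show ?thesis by auto
  qed
  moreover have "card {x \<in> set (?L @ (?a + 1) # - v # ?R). x < ?a + 1} \<le> length ?R"
  proof -
    have "{x \<in> uminus ` ?S. x < - a} = uminus ` {x \<in> ?S. x > a}" by force
    then show ?thesis unfolding a S[unfolded a] using assms(6) by (simp add: card_image del: set_append list.set)
  qed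
  ultimately have *: "settle_swap ?a ?L (?a + 1) (- v) ?R = settle ?L (?a + 1) (- v) ?R"
    using settle_swap_origin_upper[of ?L ?a "- v" ?R] assms(4,5) by simp
  have m: "map (transpose ?a (- a)) (map uminus xs) = map uminus (map (swap a) xs)" for xs
    by (simp only: map_map comp_def swap_uminus)
  have "rev (map uminus (settle_swap a L a v R)) = rev (map uminus (settle L a v R))"
    using * unfolding a m swap_uminus settle_reflect .
  then show ?thesis by (simp add: inj_map_eq_map)
qed

subsection \<open>Realising the rounds by toppling moves\<close>

text \<open>A word lists the chip sets of consecutive positions. Only a position with exactly two
  chips topples here, so it is left empty.\<close>

inductive wstep :: "nat set list \<Rightarrow> nat set list \<Rightarrow> bool" where
  "p < q \<Longrightarrow> wstep (xs @ A # {p, q} # B # ys) (xs @ insert p A # {} # insert q B # ys)"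

lemma wstep_pair:
  assumes "l \<noteq> c"
  shows "wstep (xs @ A # {l, c} # B # ys) (xs @ insert (min c l) A # {} # insert (max c l) B # ys)"
proof -
  have "{l, c} = {min c l, max c l}" by (auto simp: min_def max_def)
  moreover have "min c l < max c l" using assms by (auto simp: min_def max_def)
  ultimately show ?thesis using wstep.intros[of "min c l" "max c l" xs A B ys] by simp
qed

abbreviation single :: "'a \<Rightarrow> 'a set" where
  "single x \<equiv> {x}"

text \<open>The first chip pushed back enters \<open>B\<close>, each later one the position just
  vacated. In the end the position next to the emitted chip is empty and serves as the margin of the
  next round.\<close>

lemma wsteps_left_pass:
  assumes "distinct (c # l # ls)"
  shows "wstep\<^sup>*\<^sup>* (pre @ {} # map single (rev ls) @ {l, c} # B # post)
    (pre @ {foldl min c (l # ls)} # {} # map single (rev (tl (kept min max c (l # ls)))) @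
       insert (hd (kept min max c (l # ls))) B # post)"
  using assms
proof (induction ls arbitrary: l c B post)
  case Nil
  then show ?case using wstep_pair[of l c pre "{}" B post] by auto
next
  case (Cons l2 ls)
  have "wstep (pre @ {} # map single (rev (l2 # ls)) @ {l, c} # B # post)
    (pre @ {} # map single (rev ls) @ {l2, min c l} # {} # (insert (max c l) B # post))"
    using wstep_pair[of l c "pre @ {} # map single (rev ls)" "{l2}" B post] Cons.prems
    by (simp add: insert_commute)
  moreover have "distinct (min c l # l2 # ls)" using Cons.prems by (auto simp: min_def)
  note Cons.IH[OF this, of "{}" "insert (max c l) B # post"]
  ultimately have "wstep\<^sup>*\<^sup>* (pre @ {} # map single (rev (l2 # ls)) @ {l, c} # B # post)
    (pre @ {foldl min (min c l) (l2 # ls)} # {} # map single (rev (tl (kept min max (min c l) (l2 # ls)))) @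
       insert (hd (kept min max (min c l) (l2 # ls))) {} # (insert (max c l) B # post))"
    by (rule converse_rtranclp_into_rtranclp)
  then show ?case by simp
qed

lemma wsteps_right_pass:
  assumes "distinct (d # r # rs)"
  shows "wstep\<^sup>*\<^sup>* (pre @ B # {r, d} # map single rs @ {} # post)
    (pre @ insert (hd (kept max min d (r # rs))) B # map single (tl (kept max min d (r # rs))) @
       {} # {foldl max d (r # rs)} # post)"
  using assms
proof (induction rs arbitrary: r d B pre)
  case Nil
  then show ?case using wstep_pair[of r d pre B "{}" post] by auto
next
  case (Cons r2 rs)
  have "wstep (pre @ B # {r, d} # map single (r2 # rs) @ {} # post)
    ((pre @ [insert (min d r) B]) @ {} # {r2, max d r} # map single rs @ {} # post)"
    using wstep_pair[of r d pre B "{r2}" "map single rs @ {} # post"] Cons.prems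
    by (simp add: insert_commute)
  moreover have "distinct (max d r # r2 # rs)" using Cons.prems by (auto simp: max_def)
  note Cons.IH[OF this, of "pre @ [insert (min d r) B]" "{}"]
  ultimately have "wstep\<^sup>*\<^sup>* (pre @ B # {r, d} # map single (r2 # rs) @ {} # post)
     ((pre @ [insert (min d r) B]) @ insert (hd (kept max min (max d r) (r2 # rs))) {} #
       map single (tl (kept max min (max d r) (r2 # rs))) @
       {} # {foldl max (max d r) (r2 # rs)} # post)"
    by (rule converse_rtranclp_into_rtranclp)
  then show ?case by simp
qed

lemma concat_singles: "concat (map sorted_list_of_set (map single xs)) = xs"
  for xs :: "nat list"
  by (induction xs) auto

text \<open>\<open>pre\<close> and \<open>post\<close> absorb the chips emitted by earlier rounds,
  while the window between them shrinks by one position on each side.\<close>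

lemma wsteps_settle:
  assumes "distinct (L @ u # v # R)"
  shows "\<exists>F. wstep\<^sup>*\<^sup>* (pre @ {} # map single (rev L) @ {u, v} # map single R @ {} # post) (pre @ F @ post) \<and>
    (\<forall>A\<in>set F. card A < 2) \<and> concat (map sorted_list_of_set F) = settle L u v R"
  using assms
proof (induction L u v R arbitrary: pre post rule: settle.induct)
  case (1 L u v R)
  note d = "1.prems" and dm = distinct_min_max[OF "1.prems"]
  have uv: "v \<noteq> u" using d by auto
  have card_single: "\<forall>A\<in>set (map single xs). card A < 2" for xs :: "nat list" by auto
  show ?case
  proof (cases L)
    case Nil
    show ?thesis
    proof (cases R)
      case Nil
      have "wstep (pre @ {} # {u, v} # {} # post) (pre @ [{min u v}, {}, {max u v}] @ post)"
        using wstep_pair[of v u pre "{}" "{}" post] uv by (simp add: insert_commute)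
      then have "wstep\<^sup>*\<^sup>* (pre @ {} # {u, v} # {} # post) (pre @ [{min u v}, {}, {max u v}] @ post)" by (rule r_into_rtranclp)
      moreover have "settle L u v R = [min u v, max u v]"
        using \<open>L = []\<close> Nil by (subst settle_unfold) simp
      ultimately show ?thesis
        using \<open>L = []\<close> Nil by (intro exI[of _ "[{min u v}, {}, {max u v}]"]) simp
    next
      case (Cons r rs)
      let ?F = "{min u v} # map single (keptR R u v) @ [{}, {outR R u v}]"
      have k: "hd (keptR R u v) # tl (keptR R u v) = keptR R u v" using Cons by simp
      have s1: "wstep (pre @ {} # {u, v} # {r} # map single rs @ {} # post)
         ((pre @ [{min u v}]) @ {} # {r, max u v} # map single rs @ {} # post)"
        using wstep_pair[of v u pre "{}" "{r}" "map single rs @ {} # post"] uv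
        by (simp add: insert_commute)
      have s2: "wstep\<^sup>*\<^sup>* ((pre @ [{min u v}]) @ {} # {r, max u v} # map single rs @ {} # post)
        ((pre @ [{min u v}]) @ {hd (keptR R u v)} # map single (tl (keptR R u v)) @
         {} # {outR R u v} # post)"
        using wsteps_right_pass[of "max u v" r rs "pre @ [{min u v}]" "{}" post] dm(2) Cons
        by simp
      have s3: "(pre @ [{min u v}]) @ {hd (keptR R u v)} # map single (tl (keptR R u v)) @
         {} # {outR R u v} # post = pre @ ?F @ post"
        using arg_cong[OF k, of "map single"] by simp
      have *: "wstep\<^sup>*\<^sup>* (pre @ {} # {u, v} # {r} # map single rs @ {} # post) (pre @ ?F @ post)"
        by (rule converse_rtranclp_into_rtranclp[OF s1 s2[unfolded s3]])
      have "concat (map sorted_list_of_set ?F) = settle L u v R"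
        using \<open>L = []\<close> by (subst settle_unfold) (simp add: concat_singles[unfolded map_map comp_def] comp_def)
      moreover have "\<forall>A\<in>set ?F. card A < 2" using card_single by auto
      ultimately show ?thesis
        using \<open>L = []\<close> Cons * by (intro exI[of _ ?F] conjI) auto
    qed
  next
    case L: (Cons l ls)
    have kl: "hd (keptL L u v) # tl (keptL L u v) = keptL L u v" using L by simp
    have revkl: "map single (rev (keptL L u v)) = map single (rev (tl (keptL L u v))) @ [{hd (keptL L u v)}]"
      by (subst kl[symmetric]) simp
    \<comment> \<open>Topple the origin and sweep left, while \<open>max u v\<close> waits at
      \<open>X\<close>, the position to the right of the origin.\<close>
    have left: "wstep\<^sup>*\<^sup>* (pre @ {} # map single (rev L) @ {u, v} # X # ys)
         (pre @ {outL L u v} # {} # map single (rev (keptL L u v)) @ insert (max u v) X # ys)" for X ys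
    proof -
      have s1: "wstep (pre @ {} # map single (rev L) @ {u, v} # X # ys)
         (pre @ {} # map single (rev ls) @ {l, min u v} # {} # (insert (max u v) X # ys))"
        using wstep_pair[of v u "pre @ {} # map single (rev ls)" "{l}" X ys] uv L
        by (simp add: insert_commute)
      have s2: "wstep\<^sup>*\<^sup>* (pre @ {} # map single (rev ls) @ {l, min u v} # {} # (insert (max u v) X # ys))
        (pre @ {outL L u v} # {} # map single (rev (tl (keptL L u v))) @
        {hd (keptL L u v)} # (insert (max u v) X # ys))"
        using wsteps_left_pass[of "min u v" l ls pre "{}" "insert (max u v) X # ys"] dm(1) L
        by simp
      have s3: "pre @ {outL L u v} # {} # map single (rev (tl (keptL L u v))) @
        {hd (keptL L u v)} # (insert (max u v) X # ys) =
        pre @ {outL L u v} # {} # map single (rev (keptL L u v)) @ insert (max u v) X # ys"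
        unfolding revkl by simp
      show ?thesis by (rule converse_rtranclp_into_rtranclp[OF s1 s2[unfolded s3]])
    qed
    show ?thesis
    proof (cases R)
      case Nil
      let ?F = "{outL L u v} # {} # map single (rev (keptL L u v)) @ [{max u v}]"
      have "concat (map sorted_list_of_set ?F) = settle L u v R"
        using Nil by (subst settle_unfold) (simp add: concat_singles[unfolded map_map comp_def] comp_def)
      moreover have "\<forall>A\<in>set ?F. card A < 2" using card_single by auto
      ultimately show ?thesis
        using Nil left[of "{}" post] by (intro exI[of _ ?F] conjI) auto
    next
      case R: (Cons r rs)
      have ne: "\<not> (L = [] \<or> R = [])" using L R by simp
      let ?kl = "keptL L u v" and ?kr = "keptR R u v"
      let ?pre = "pre @ [{outL L u v}]" and ?post = "{outR R u v} # post"
      have s1: "wstep\<^sup>*\<^sup>* (pre @ {} # map single (rev L) @ {u, v} # map single R @ {} # post)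
         (pre @ {outL L u v} # {} # map single (rev ?kl) @ insert (max u v) {r} # map single rs @ {} # post)"
        using left[of "{r}" "map single rs @ {} # post"] R by simp
      have s2: "pre @ {outL L u v} # {} # map single (rev ?kl) @ insert (max u v) {r} # map single rs @ {} # post =
        (?pre @ {} # map single (rev (tl ?kl))) @ {hd ?kl} # {r, max u v} # map single rs @ {} # post"
        unfolding revkl by (simp add: insert_commute)
      \<comment> \<open>The right sweep pushes its first chip onto the origin, where
        \<open>hd ?kl\<close> already lies; these two start the next round.\<close>
      have s3: "wstep\<^sup>*\<^sup>* ((?pre @ {} # map single (rev (tl ?kl))) @ {hd ?kl} # {r, max u v} # map single rs @ {} # post)
        ((?pre @ {} # map single (rev (tl ?kl))) @ insert (hd ?kr) {hd ?kl} #
         map single (tl ?kr) @ {} # ?post)"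
        using wsteps_right_pass[of "max u v" r rs "?pre @ {} # map single (rev (tl ?kl))" "{hd ?kl}" post]
          dm(2) R by simp
      have s4: "(?pre @ {} # map single (rev (tl ?kl))) @ insert (hd ?kr) {hd ?kl} #
         map single (tl ?kr) @ {} # ?post =
         ?pre @ {} # map single (rev (tl ?kl)) @ {hd ?kl, hd ?kr} # map single (tl ?kr) @ {} # ?post"
        by (simp add: insert_commute)
      have *: "wstep\<^sup>*\<^sup>* (pre @ {} # map single (rev L) @ {u, v} # map single R @ {} # post)
        (?pre @ {} # map single (rev (tl ?kl)) @ {hd ?kl, hd ?kr} # map single (tl ?kr) @ {} # ?post)"
        by (rule rtranclp_trans[OF s1[unfolded s2] s3[unfolded s4]])
      have kr: "hd ?kr # tl ?kr = ?kr" using R by simp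
      have "distinct (tl ?kl @ (hd ?kl # hd ?kr # tl ?kr))"
      proof -
        have "distinct (?kl @ ?kr)" using distinct_round[OF d] by auto
        then show ?thesis by (subst (asm) (1) kl[symmetric], subst kr) auto
      qed
      then obtain F where F: "wstep\<^sup>*\<^sup>* (?pre @ {} # map single (rev (tl ?kl)) @ {hd ?kl, hd ?kr} #
          map single (tl ?kr) @ {} # ?post) (?pre @ F @ ?post)"
        "\<forall>A\<in>set F. card A < 2"
        "concat (map sorted_list_of_set F) = settle (tl ?kl) (hd ?kl) (hd ?kr) (tl ?kr)"
        using "1.IH"[OF refl refl ne, of ?pre ?post] by blast
      let ?F = "{outL L u v} # F @ [{outR R u v}]"
      have "concat (map sorted_list_of_set ?F) = settle L u v R"
        using ne F(3) by (subst settle_unfold) simp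
      moreover have "wstep\<^sup>*\<^sup>* (pre @ {} # map single (rev L) @ {u, v} # map single R @ {} # post)
          (pre @ ?F @ post)"
        using rtranclp_trans[OF * F(1)] by (simp only: append.simps append_assoc)
      ultimately show ?thesis using F(2) by (intro exI[of _ ?F] conjI) auto
    qed
  qed
qed

subsection \<open>Independence of the choices\<close>

definition cfg :: "nat \<Rightarrow> nat set list \<Rightarrow> config" where
  "cfg n W = (\<lambda>i. if i \<in> positions n then W ! nat (i - left_end n) else {})"

lemma right_end_eq: "right_end n = left_end n + int n + 1"
  unfolding right_end_def left_end_def by presburger

lemma wstep_cfg:
  assumes "wstep W W'" "length W = n + 2"
  shows "toppling_step n (cfg n W) (cfg n W')" "length W' = n + 2"
proof -
  from assms(1) obtain p q xs A B ys where pq: "p < q"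
    and W: "W = xs @ A # {p, q} # B # ys" "W' = xs @ insert p A # {} # insert q B # ys"
    by (auto elim: wstep.cases)
  show "length W' = n + 2" using assms(2) W by simp
  let ?k = "length xs"
  \<comment> \<open>The toppling position is the middle one of the three after \<open>xs\<close>,
    hence the additional \<open>1\<close>.\<close>
  let ?i = "left_end n + int ?k + 1"
  have len: "?k + 3 \<le> n + 2" using assms(2) W(1) by simp
  have nth: "W ! j = (if j = ?k then A else if j = ?k + 1 then {p, q} else if j = ?k + 2 then B else W' ! j)"
    "W' ! j = (if j = ?k then insert p A else if j = ?k + 1 then {} else if j = ?k + 2 then insert q B else W ! j)" for j
    unfolding W by (auto simp: nth_append nth_Cons' eval_nat_numeral)
  have W1: "W ! ?k = A" "W ! (?k + 1) = {p, q}" "W ! (?k + 2) = B"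
    unfolding W by (simp_all add: nth_append)
  have i: "?i \<in> positions n" "?i - 1 \<in> positions n" "?i + 1 \<in> positions n"
    using len by (auto simp: positions_def right_end_eq)
  have c: "cfg n W ?i = {p, q}" "cfg n W (?i - 1) = A" "cfg n W (?i + 1) = B"
    using i W1 unfolding cfg_def by (simp_all add: nat_add_distrib add.commute)
  have "cfg n W' = move (cfg n W) ?i p q"
  proof
    fix j
    show "cfg n W' j = move (cfg n W) ?i p q j"
    proof (cases "j \<in> positions n")
      case True
      then obtain t where j: "j = left_end n + int t"
        by (auto simp: positions_def intro: that[of "nat (j - left_end n)"])
      have "cfg n W' j = W' ! t" "cfg n W j = W ! t"
        using True unfolding cfg_def j by simp_all
      moreover have "?i = j \<longleftrightarrow> t = ?k + 1" "?i - 1 = j \<longleftrightarrow> t = ?k" "?i + 1 = j \<longleftrightarrow> t = ?k + 2"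
        unfolding j by auto
      ultimately show ?thesis
        using nth(2)[of t] c unfolding move_def by (auto simp: fun_upd_apply)
    next
      case False
      then have "j \<noteq> ?i" "j \<noteq> ?i - 1" "j \<noteq> ?i + 1" using i by auto
      with False show ?thesis unfolding move_def cfg_def by (simp add: fun_upd_apply)
    qed
  qed
  then show "toppling_step n (cfg n W) (cfg n W')"
    unfolding toppling_step_def using i(1) c(1) pq by blast
qed

lemma wsteps_cfg:
  assumes "wstep\<^sup>*\<^sup>* W W'" "length W = n + 2"
  shows "(toppling_step n)\<^sup>*\<^sup>* (cfg n W) (cfg n W') \<and> length W' = n + 2"
  using assms
proof (induction rule: rtranclp_induct)
  case (step W' W'')
  then show ?case using wstep_cfg[of W' W'' n] by (meson rtranclp.rtrancl_into_rtrancl)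
qed simp

lemma map_cfg:
  assumes "length W = n + 2"
  shows "map (cfg n W) [left_end n..right_end n] = W"
proof (rule nth_equalityI)
  show l: "length (map (cfg n W) [left_end n..right_end n]) = length W"
    using assms by (simp add: right_end_eq)
  fix k assume "k < length (map (cfg n W) [left_end n..right_end n])"
  then have k: "k < n + 2" using l assms by simp
  have "[left_end n..right_end n] ! k = left_end n + int k"
    using k by (simp add: right_end_eq)
  moreover have "cfg n W (left_end n + int k) = W ! k"
    using k by (simp add: cfg_def positions_def right_end_eq)
  ultimately show "map (cfg n W) [left_end n..right_end n] ! k = W ! k"
    using k by (simp add: right_end_eq)
qed

lemma stable_cfg:
  assumes "length W = n + 2"
  shows "stable n (cfg n W) \<longleftrightarrow> (\<forall>A\<in>set W. card A < 2)"
proof -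
  have "set W = cfg n W ` positions n"
    using arg_cong[OF map_cfg[OF assms], of set] by (simp add: positions_def)
  then show ?thesis unfolding stable_def by simp
qed

lemma reading_word_cfg:
  assumes "length W = n + 2"
  shows "reading_word n (cfg n W) = concat (map sorted_list_of_set W)"
proof -
  have "reading_word n (cfg n W) = concat (map sorted_list_of_set (map (cfg n W) [left_end n..right_end n]))"
    by (simp add: reading_word_def comp_def)
  then show ?thesis by (simp only: map_cfg[OF assms])
qed

text \<open>Positions with two chips are separated by empty ones. Hence neighbouring positions never
  both topple, a position that topples holds exactly two chips, and toppling has the diamond
  property.\<close>

definition separated :: "config \<Rightarrow> bool" where
  "separated c \<longleftrightarrow> (\<forall>i. finite (c i) \<and> card (c i) \<le> 2) \<and>
     (\<forall>i j. i < j \<and> card (c i) = 2 \<and> card (c j) = 2 \<longrightarrow> (\<exists>k. i < k \<and> k < j \<and> c k = {}))"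

lemma separated_pair:
  assumes "separated c" "p \<in> c i" "q \<in> c i" "p < q"
  shows "c i = {p, q}"
proof -
  have "finite (c i)" "card (c i) \<le> 2" using assms(1) by (auto simp: separated_def)
  moreover have "{p, q} \<subseteq> c i" "card {p, q} = 2" using assms(2-4) by auto
  ultimately show ?thesis by (metis card_seteq)
qed

lemma separated_adjacent:
  assumes "separated c" "c i = {p, q}" "p < q" "c j = {p', q'}" "p' < q'" "i \<noteq> j"
  shows "j \<noteq> i + 1" "j \<noteq> i - 1"
proof -
  have card: "card (c i) = 2" "card (c j) = 2" using assms by auto
  have sep: "\<And>i j. i < j \<Longrightarrow> card (c i) = 2 \<Longrightarrow> card (c j) = 2 \<Longrightarrow> \<exists>k. i < k \<and> k < j"
    using assms(1) unfolding separated_def by blast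
  show "j \<noteq> i + 1" "j \<noteq> i - 1"
    using sep[of i j] sep[of j i] card by force+
qed

text \<open>New pairs arise only next to \<open>i\<close>, and \<open>i\<close> becomes the gap
  between its two sides. A new pair at \<open>i - 1\<close> or \<open>i + 1\<close> is separated
  from a pair further out by the gap that separated the latter from \<open>i\<close>.\<close>

lemma separated_move:
  assumes "separated c" "p \<in> c i" "q \<in> c i" "p < q"
  shows "separated (move c i p q)"
proof -
  let ?d = "move c i p q"
  note ci = separated_pair[OF assms]
  have fin: "finite (c j)" "card (c j) \<le> 2" for j using assms(1) by (auto simp: separated_def)
  have sep: "\<exists>k. i < k \<and> k < j \<and> c k = {}" if "i < j" "card (c i) = 2" "card (c j) = 2" for i j
    using assms(1) that unfolding separated_def by blast
  have ci2: "card (c i) = 2" using ci assms(4) by simp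
  have nb: "card (c (i - 1)) \<noteq> 2" "card (c (i + 1)) \<noteq> 2"
    using sep[of "i - 1" i] sep[of i "i + 1"] ci2 by force+
  have d: "?d i = {}" "?d (i - 1) = insert p (c (i - 1))" "?d (i + 1) = insert q (c (i + 1))"
    "\<And>j. j \<noteq> i \<Longrightarrow> j \<noteq> i - 1 \<Longrightarrow> j \<noteq> i + 1 \<Longrightarrow> ?d j = c j"
    using ci by (auto simp: move_def)
  have fd: "finite (?d j) \<and> card (?d j) \<le> 2" for j
  proof -
    consider "j = i" | "j = i - 1" | "j = i + 1" | "j \<noteq> i" "j \<noteq> i - 1" "j \<noteq> i + 1" by blast
    then show ?thesis
    proof cases
      case 1 then show ?thesis using d by simp
    next
      case 2 then show ?thesis using d(2) nb(1) fin[of j] by (simp add: card_insert_if)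
    next
      case 3 then show ?thesis using d(3) nb(2) fin[of j] by (simp add: card_insert_if)
    next
      case 4 then show ?thesis using d(4) fin by simp
    qed
  qed
  \<comment> \<open>A neighbour of \<open>i\<close> that ends with two chips was occupied before, so
    it was not the old gap.\<close>
  have old: "c k \<noteq> {}" if "card (?d k) = 2" "k \<in> {i - 1, i + 1}" for k
    using that d by auto
  have same: "card (?d j) = 2 \<Longrightarrow> card (c j) = 2 \<or> j = i - 1 \<or> j = i + 1" for j
    using d(1) d(4)[of j] by (cases "j = i"; cases "j = i - 1"; cases "j = i + 1") auto
  have main: "\<exists>k. j < k \<and> k < l \<and> ?d k = {}"
    if jl: "j < l" and cj: "card (?d j) = 2" and cl: "card (?d l) = 2" for j l
  proof -
    have ne: "j \<noteq> i" "l \<noteq> i" using cj cl d(1) by auto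
    consider "j < i" "i < l" | "l < i" | "i < j" using ne jl by linarith
    then show ?thesis
    proof cases
      case 1
      then show ?thesis using d(1) by blast
    next
      case 2
      then have "card (c j) = 2" using same[OF cj] jl by auto
      show ?thesis
      proof (cases "l = i - 1")
        case True
        obtain k where k: "j < k" "k < i" "c k = {}"
          using sep[of j i] \<open>card (c j) = 2\<close> ci2 jl 2 by auto
        have "k \<noteq> i - 1" using old[of l] cl True k(3) by auto
        then show ?thesis using k d(4)[of k] True by (intro exI[of _ k]) auto
      next
        case False
        then have "card (c l) = 2" using same[OF cl] 2 by auto
        then obtain k where k: "j < k" "k < l" "c k = {}"
          using sep[of j l] \<open>card (c j) = 2\<close> jl by auto
        then show ?thesis using d(4)[of k] 2 False by (intro exI[of _ k]) auto
      qed
    next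
      case 3
      then have "card (c l) = 2" using same[OF cl] jl by auto
      show ?thesis
      proof (cases "j = i + 1")
        case True
        obtain k where k: "i < k" "k < l" "c k = {}"
          using sep[of i l] \<open>card (c l) = 2\<close> ci2 jl 3 by auto
        have "k \<noteq> i + 1" using old[of j] cj True k(3) by auto
        then show ?thesis using k d(4)[of k] True by (intro exI[of _ k]) auto
      next
        case False
        then have "card (c j) = 2" using same[OF cj] 3 by auto
        then obtain k where k: "j < k" "k < l" "c k = {}"
          using sep[of j l] \<open>card (c l) = 2\<close> jl by auto
        then show ?thesis using d(4)[of k] 3 False by (intro exI[of _ k]) auto
      qed
    qed
  qed
  show ?thesis unfolding separated_def using fd main by blast
qed

lemma separated_step: "separated c \<Longrightarrow> toppling_step n c c' \<Longrightarrow> separated c'"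
  unfolding toppling_step_def using separated_move by blast

text \<open>Distinct toppling positions are not adjacent, so neither move touches the pair of the
  other. At distance two both merely add a chip to the position between.\<close>

lemma toppling_diamond:
  assumes "separated c" "toppling_step n c c1" "toppling_step n c c2"
  shows "c1 = c2 \<or> (\<exists>d. toppling_step n c1 d \<and> toppling_step n c2 d)"
proof -
  from assms(2) obtain i p q where 1: "i \<in> positions n" "p \<in> c i" "q \<in> c i" "p < q" "c1 = move c i p q"
    unfolding toppling_step_def by blast
  from assms(3) obtain j p' q' where 2: "j \<in> positions n" "p' \<in> c j" "q' \<in> c j" "p' < q'" "c2 = move c j p' q'"
    unfolding toppling_step_def by blast
  note ci = separated_pair[OF assms(1) 1(2-4)] and cj = separated_pair[OF assms(1) 2(2-4)]
  show ?thesis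
  proof (cases "i = j")
    case True
    with ci cj have "{p, q} = {p', q'}" by simp
    with 1(4) 2(4) have "p = p'" "q = q'" unfolding doubleton_eq_iff by auto
    with True 1 2 show ?thesis by simp
  next
    case False
    note adj = separated_adjacent[OF assms(1) ci 1(4) cj 2(4) False]
    have far: "i \<noteq> j" "j \<noteq> i" "j \<noteq> i + 1" "j \<noteq> i - 1" "i \<noteq> j + 1" "i \<noteq> j - 1"
      using False adj by auto
    have m: "c1 j = c j" "c2 i = c i"
      using far 1(5) 2(5) by (simp_all add: move_def)
    have "move c1 j p' q' = move c2 i p q"
    proof
      fix k
      consider "k = i" | "k = j" | "k = i - 1" | "k = i + 1" | "k \<noteq> i" "k \<noteq> j" "k \<noteq> i - 1" "k \<noteq> i + 1"
        by blast
      then show "move c1 j p' q' k = move c2 i p q k"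
        by cases (use far in \<open>auto simp: move_def 1(5) 2(5) add.commute\<close>)
    qed
    moreover have "toppling_step n c1 (move c1 j p' q')"
      unfolding toppling_step_def using 2 m by force
    moreover have "toppling_step n c2 (move c2 i p q)"
      unfolding toppling_step_def using 1 m by force
    ultimately show ?thesis by metis
  qed
qed

text \<open>Diamonds are pasted along the run; each closes with at most one move, so at most one is
  left at the far end.\<close>

lemma toppling_strip:
  assumes "(toppling_step n)\<^sup>*\<^sup>* c d" "separated c" "toppling_step n c c'"
  shows "\<exists>e. (toppling_step n)\<^sup>*\<^sup>* c' e \<and> (d = e \<or> toppling_step n d e)"
  using assms
proof (induction arbitrary: c' rule: converse_rtranclp_induct)
  case base
  then show ?case by blast
next
  case (step c c1)
  from toppling_diamond[OF step.prems(1) step.hyps(1) step.prems(2)] show ?case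
  proof
    assume "c1 = c'"
    with step.hyps(2) show ?thesis by blast
  next
    assume "\<exists>x. toppling_step n c1 x \<and> toppling_step n c' x"
    then obtain x where x: "toppling_step n c1 x" "toppling_step n c' x" by blast
    from step.IH[OF separated_step[OF step.prems(1) step.hyps(1)] x(1)]
    obtain e where "(toppling_step n)\<^sup>*\<^sup>* x e" "d = e \<or> toppling_step n d e" by blast
    then show ?thesis using x(2) converse_rtranclp_into_rtranclp by metis
  qed
qed

lemma stable_no_step:
  assumes "separated c" "stable n c"
  shows "\<not> toppling_step n c d"
proof
  assume "toppling_step n c d"
  then obtain i p q where *: "i \<in> positions n" "p \<in> c i" "q \<in> c i" "p < q"
    unfolding toppling_step_def by blast
  then have "card (c i) = 2" using separated_pair[OF assms(1) *(2-4)] by simp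
  then show False using assms(2) *(1) unfolding stable_def by force
qed

lemma separated_steps: "(toppling_step n)\<^sup>*\<^sup>* c d \<Longrightarrow> separated c \<Longrightarrow> separated d"
  by (induction rule: rtranclp_induct) (auto intro: separated_step)

text \<open>Follow the run to \<open>d\<close> step by step: the strip lemma reroutes the other run
  through each configuration, and it still ends in \<open>d'\<close> because \<open>d'\<close>
  admits no move.\<close>

lemma stable_unique:
  assumes "(toppling_step n)\<^sup>*\<^sup>* c d" "separated c" "stable n d"
    and "(toppling_step n)\<^sup>*\<^sup>* c d'" "stable n d'"
  shows "d' = d"
  using assms
proof (induction rule: converse_rtranclp_induct)
  case base
  then show ?case using stable_no_step by (metis converse_rtranclpE)
next
  case (step c c1)
  from toppling_strip[OF step.prems(3) step.prems(1) step.hyps(1)]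
  obtain e where e: "(toppling_step n)\<^sup>*\<^sup>* c1 e" "d' = e \<or> toppling_step n d' e" by blast
  have "separated d'" using separated_steps step.prems by blast
  then have "d' = e" using e(2) stable_no_step step.prems by blast
  with e step separated_step show ?case by blast
qed

subsection \<open>The initial configuration\<close>

definition label :: "(nat \<Rightarrow> nat) \<Rightarrow> nat \<Rightarrow> nat \<Rightarrow> nat" where
  "label \<pi> r j = (if \<pi> j < r then \<pi> j else \<pi> j + 1)"

text \<open>For \<open>n >= 1\<close> this is the index of the entry placed at the origin, and
  \<open>left_end n\<close> is its negative.\<close>

abbreviation center :: "nat \<Rightarrow> nat" where
  "center n \<equiv> (n + 1) div 2"

definition left_chips :: "nat \<Rightarrow> (nat \<Rightarrow> nat) \<Rightarrow> nat \<Rightarrow> nat list" where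
  "left_chips n \<pi> r = rev (map (label \<pi> r) [1..<center n])"

definition right_chips :: "nat \<Rightarrow> (nat \<Rightarrow> nat) \<Rightarrow> nat \<Rightarrow> nat list" where
  "right_chips n \<pi> r = map (label \<pi> r) [center n + 1..<n + 1]"

abbreviation outcome :: "nat \<Rightarrow> (nat \<Rightarrow> nat) \<Rightarrow> nat \<Rightarrow> nat list" where
  "outcome n \<pi> r \<equiv> settle (left_chips n \<pi> r) r (label \<pi> r (center n)) (right_chips n \<pi> r)"

lemma upt_center:
  assumes "n \<ge> 1"
  shows "[1..<n + 1] = [1..<center n] @ center n # [center n + 1..<n + 1]"
proof -
  have "1 \<le> center n" "center n < n + 1" using assms by auto
  then show ?thesis
    using upt_add_eq_append[of 1 "center n" "n + 1 - center n"] upt_conv_Cons[of "center n" "n + 1"]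
    by simp
qed

lemma set_chips:
  assumes "n \<ge> 1" "\<pi> permutes {1..n}" "1 \<le> r" "r \<le> n + 1"
  shows "set (left_chips n \<pi> r @ r # label \<pi> r (center n) # right_chips n \<pi> r) = {1..n + 1}"
proof -
  have "set (left_chips n \<pi> r @ r # label \<pi> r (center n) # right_chips n \<pi> r) =
    insert r (label \<pi> r ` set [1..<n + 1])"
    unfolding upt_center[OF assms(1)] by (auto simp: left_chips_def right_chips_def)
  also have "label \<pi> r ` set [1..<n + 1] = (\<lambda>x. if x < r then x else x + 1) ` (\<pi> ` {1..n})"
    by (auto simp: label_def image_image)
  also have "\<pi> ` {1..n} = {1..n}" by (rule permutes_image[OF assms(2)])
  also have "insert r ((\<lambda>x. if x < r then x else x + 1) ` {1..n}) = {1..n + 1}" (is "?l = ?r")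
  proof
    show "?l \<subseteq> ?r" using assms by auto
    show "?r \<subseteq> ?l"
    proof
      fix x assume x: "x \<in> ?r"
      consider "x < r" | "x = r" | "x > r" by linarith
      then show "x \<in> ?l"
      proof cases
        case 1
        then show ?thesis using x assms by (auto intro!: image_eqI[of _ _ x])
      next
        case 3
        then show ?thesis using x assms by (auto intro!: image_eqI[of _ _ "x - 1"])
      qed simp
    qed
  qed
  finally show ?thesis .
qed

lemma length_chips:
  "length (left_chips n \<pi> r) = center n - 1" "length (right_chips n \<pi> r) = n - center n"
  unfolding left_chips_def right_chips_def length_map length_rev length_upt by linarith+

lemma distinct_chips:
  assumes "n \<ge> 1" "\<pi> permutes {1..n}" "1 \<le> r" "r \<le> n + 1"
  shows "distinct (left_chips n \<pi> r @ r # label \<pi> r (center n) # right_chips n \<pi> r)"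
proof (rule card_distinct)
  have "1 \<le> center n" "center n \<le> n" using assms by auto
  then show "card (set (left_chips n \<pi> r @ r # label \<pi> r (center n) # right_chips n \<pi> r)) =
    length (left_chips n \<pi> r @ r # label \<pi> r (center n) # right_chips n \<pi> r)"
    unfolding set_chips[OF assms] card_atLeastAtMost list.size length_append
    using length_chips[of n \<pi> r] by linarith
qed

abbreviation initial_word :: "nat \<Rightarrow> (nat \<Rightarrow> nat) \<Rightarrow> nat \<Rightarrow> nat set list" where
  "initial_word n \<pi> r \<equiv> {} # map single (rev (left_chips n \<pi> r)) @ {r, label \<pi> r (center n)} #
     map single (right_chips n \<pi> r) @ [{}]"

text \<open>Index \<open>k\<close> stands for position \<open>k - center n\<close>, so indices
  \<open>0\<close> and \<open>n + 1\<close> are the empty margins.\<close>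

lemma initial_word_nth:
  assumes "n \<ge> 1" "k < n + 2"
  shows "initial_word n \<pi> r ! k =
    {label \<pi> r j | j. j \<in> {1..n} \<and> j = k} \<union> (if k = center n then {r} else {})"
proof -
  define f where "f k = {label \<pi> r j | j. j \<in> {1..n} \<and> j = k} \<union> (if k = center n then {r} else {})" for k
  have c: "1 \<le> center n" "center n \<le> n" using assms by auto
  have "[0..<n + 2] = 0 # [1..<n + 1] @ [n + 1]"
    by (simp add: upt_conv_Cons)
  then have "map f [0..<n + 2] = f 0 # map f [1..<center n] @ f (center n) # map f [center n + 1..<n + 1] @ [f (n + 1)]"
    unfolding upt_center[OF assms(1)] by simp
  moreover have "f 0 = {}" "f (n + 1) = {}" "f (center n) = {r, label \<pi> r (center n)}"
    using c by (auto simp: f_def)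
  moreover have "map f [1..<center n] = map single (rev (left_chips n \<pi> r))"
    using c by (auto simp: f_def left_chips_def)
  moreover have "map f [center n + 1..<n + 1] = map single (right_chips n \<pi> r)"
    using c by (auto simp: f_def right_chips_def)
  ultimately have "initial_word n \<pi> r = map f [0..<n + 2]" by simp
  then show ?thesis using assms(2) by (simp add: f_def del: upt_Suc)
qed

lemma length_initial_word:
  assumes "n \<ge> 1"
  shows "length (initial_word n \<pi> r) = n + 2"
proof -
  have "1 \<le> center n" "center n \<le> n" using assms by auto
  then show ?thesis
    using length_chips[of n \<pi> r] unfolding list.size length_append length_map length_rev
    by linarith
qed

lemma initial_config_eq:
  assumes "n \<ge> 1"
  shows "initial_config n \<pi> r = cfg n (initial_word n \<pi> r)"
proof
  fix i
  have le: "left_end n = - int (center n)" by (simp add: left_end_def zdiv_int)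
  have ctr: "- ((int n - 1) div 2) - 1 = - int (center n)"
    using assms by (simp add: zdiv_int)
  then have init: "initial_config n \<pi> r i =
    {label \<pi> r j | j. j \<in> {1..n} \<and> i = int j - int (center n)} \<union> (if i = 0 then {r} else {})"
    unfolding initial_config_def label_def by (simp add: algebra_simps)
  show "initial_config n \<pi> r i = cfg n (initial_word n \<pi> r) i"
  proof (cases "i \<in> positions n")
    case True
    then obtain k where k: "i = int k - int (center n)" "k < n + 2"
      using le by (auto simp: positions_def right_end_eq intro: that[of "nat (i + int (center n))"])
    have "cfg n (initial_word n \<pi> r) i = initial_word n \<pi> r ! k"
      using True by (simp add: cfg_def le k(1))
    also note initial_word_nth[OF assms k(2)]
    finally have cfg: "cfg n (initial_word n \<pi> r) i =
      {label \<pi> r j | j. j \<in> {1..n} \<and> j = k} \<union> (if k = center n then {r} else {})" .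
    have "i = int j - int (center n) \<longleftrightarrow> j = k" for j unfolding k(1) by auto
    moreover have "i = 0 \<longleftrightarrow> k = center n" unfolding k(1) by auto
    ultimately show ?thesis unfolding cfg init by (simp only:)
  next
    case False
    then have "initial_config n \<pi> r i = {}"
      unfolding init positions_def right_end_eq le by auto
    then show ?thesis using False by (simp add: cfg_def)
  qed
qed

text \<open>Only the origin can hold two chips, so there is no second pair to be separated from
  it.\<close>

lemma separated_initial:
  assumes "n \<ge> 1"
  shows "separated (initial_config n \<pi> r)"
proof -
  have W: "cfg n (initial_word n \<pi> r) i = (if i \<in> positions n then
      {label \<pi> r j | j. j \<in> {1..n} \<and> j = nat (i + int (center n))} \<union> (if i = 0 then {r} else {}) else {})" for i
  proof (cases "i \<in> positions n")
    case True
    have le: "left_end n = - int (center n)" by (simp add: left_end_def zdiv_int)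
    have "nat (i + int (center n)) < n + 2" "i = 0 \<longleftrightarrow> nat (i + int (center n)) = center n"
      using True le by (auto simp: positions_def right_end_eq)
    then show ?thesis using initial_word_nth[OF assms] True
      by (simp add: cfg_def le)
  qed (simp add: cfg_def)
  have sub: "cfg n (initial_word n \<pi> r) i \<subseteq>
      (if i = 0 then {label \<pi> r (nat (i + int (center n))), r} else {label \<pi> r (nat (i + int (center n)))})" for i
    unfolding W by auto
  have fc: "finite (cfg n (initial_word n \<pi> r) i)"
    "card (cfg n (initial_word n \<pi> r) i) \<le> (if i = 0 then 2 else 1)" for i
  proof -
    have fin: "finite (if i = 0 then {label \<pi> r (nat (i + int (center n))), r}
      else {label \<pi> r (nat (i + int (center n)))})" by simp
    have "card (if i = 0 then {label \<pi> r (nat (i + int (center n))), r}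
      else {label \<pi> r (nat (i + int (center n)))}) \<le> (if i = 0 then 2 else 1)"
      by (simp add: card_insert_if)
    then show "finite (cfg n (initial_word n \<pi> r) i)"
      "card (cfg n (initial_word n \<pi> r) i) \<le> (if i = 0 then 2 else 1)"
      using card_mono[OF fin sub[of i]] finite_subset[OF sub[of i] fin] by linarith+
  qed
  have "card (cfg n (initial_word n \<pi> r) i) = 2 \<Longrightarrow> i = 0" for i
    using fc(2)[of i] by (simp split: if_splits)
  moreover have "card (cfg n (initial_word n \<pi> r) i) \<le> 2" for i
    using fc(2)[of i] by (simp split: if_splits)
  ultimately show ?thesis
    unfolding initial_config_eq[OF assms] separated_def using fc(1) less_irrefl by metis
qed

section \<open>Toppleability as sortedness\<close>

text \<open>The rounds are one legal run to a stable configuration, and uniqueness makes its end the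
  value of the \<open>THE\<close>.\<close>

lemma reading_word_final:
  assumes "n \<ge> 1" "\<pi> permutes {1..n}" "1 \<le> r" "r \<le> n + 1"
  shows "reading_word n (final_config n \<pi> r) = outcome n \<pi> r"
proof -
  obtain F where F: "wstep\<^sup>*\<^sup>* (initial_word n \<pi> r) F" "\<forall>A\<in>set F. card A < 2"
    "concat (map sorted_list_of_set F) = outcome n \<pi> r"
    using wsteps_settle[OF distinct_chips[OF assms], of "[]" "[]"] by auto
  from wsteps_cfg[OF F(1) length_initial_word[OF assms(1)]]
  have steps: "(toppling_step n)\<^sup>*\<^sup>* (initial_config n \<pi> r) (cfg n F)" and len: "length F = n + 2"
    unfolding initial_config_eq[OF assms(1)] by auto
  have st: "stable n (cfg n F)" using F(2) len stable_cfg by blast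
  have "final_config n \<pi> r = cfg n F"
    unfolding final_config_def
    using stable_unique[OF steps separated_initial[OF assms(1)] st] steps st by blast
  then show ?thesis using F(3) reading_word_cfg[OF len] by simp
qed

text \<open>The word lists \<open>1, ..., n + 1\<close> without repetition, and the only sorted such
  word is the identity.\<close>

lemma toppleable_iff_sorted:
  assumes "n \<ge> 1" "\<pi> permutes {1..n}" "1 \<le> r" "r \<le> n + 1"
  shows "toppleable n r \<pi> \<longleftrightarrow> sorted (outcome n \<pi> r)"
proof -
  let ?w = "outcome n \<pi> r"
  have set: "set ?w = {1..n + 1}" unfolding set_settle by (rule set_chips[OF assms])
  have dist: "distinct ?w"
    using distinct_chips[OF assms] mset_settle mset_eq_imp_distinct_iff by blast
  have len: "length ?w = n + 1" using distinct_card[OF dist] set by simp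
  have "toppleable n r \<pi> \<longleftrightarrow> (\<forall>k\<in>{1..n + 1}. ?w ! (k - 1) = k)"
    unfolding toppleable_def toppled_perm_def reading_word_final[OF assms] by (auto simp: fun_eq_iff)
  also have "\<dots> \<longleftrightarrow> ?w = [1..<n + 2]"
  proof
    assume *: "\<forall>k\<in>{1..n + 1}. ?w ! (k - 1) = k"
    show "?w = [1..<n + 2]"
    proof (rule nth_equalityI)
      show "length ?w = length [1..<n + 2]" using len by simp
      fix i assume "i < length ?w"
      then show "?w ! i = [1..<n + 2] ! i"
        using bspec[OF *, of "i + 1"] len by (simp del: upt_Suc)
    qed
  next
    assume "?w = [1..<n + 2]"
    then show "\<forall>k\<in>{1..n + 1}. ?w ! (k - 1) = k" by (auto simp del: upt_Suc)
  qed
  also have "\<dots> \<longleftrightarrow> sorted ?w"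
  proof
    assume "sorted ?w"
    moreover have "sorted [1..<n + 2]" "distinct [1..<n + 2]" by (simp_all del: upt_Suc)
    moreover have "set ?w = set [1..<n + 2]" unfolding set by auto
    ultimately show "?w = [1..<n + 2]" using sorted_distinct_set_unique dist by blast
  next
    assume "?w = [1..<n + 2]"
    then show "sorted ?w" by (simp del: upt_Suc)
  qed
  finally show ?thesis .
qed

abbreviation outcome_int :: "nat \<Rightarrow> (nat \<Rightarrow> nat) \<Rightarrow> nat \<Rightarrow> int list" where
  "outcome_int n \<pi> r \<equiv> settle (map int (left_chips n \<pi> r)) (int r) (int (label \<pi> r (center n)))
     (map int (right_chips n \<pi> r))"

lemma toppleable_iff_sorted_int:
  assumes "n \<ge> 1" "\<pi> permutes {1..n}" "1 \<le> r" "r \<le> n + 1"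
  shows "toppleable n r \<pi> \<longleftrightarrow> sorted (outcome_int n \<pi> r)"
proof -
  have "outcome_int n \<pi> r = map int (outcome n \<pi> r)"
    by (rule settle_map) (simp add: strict_mono_def)
  then show ?thesis using toppleable_iff_sorted[OF assms] by (simp add: sorted_map)
qed

text \<open>Raising \<open>r\<close> by one affects only the entry with \<open>\<pi> j = r\<close>,
  whose label falls from \<open>r + 1\<close> to \<open>r\<close>.\<close>

lemma label_swap: "swap (int r) (int (label \<pi> r j)) = int (label \<pi> (r + 1) j)"
  by (auto simp: label_def transpose_def)

lemma outcome_swap:
  "settle_swap (int r) (map int (left_chips n \<pi> r)) (int r) (int (label \<pi> r (center n)))
     (map int (right_chips n \<pi> r)) = outcome_int n \<pi> (r + 1)"
proof -
  have "map (swap (int r)) (map int (left_chips n \<pi> r)) = map int (left_chips n \<pi> (r + 1))"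
    "map (swap (int r)) (map int (right_chips n \<pi> r)) = map int (right_chips n \<pi> (r + 1))"
    by (simp_all only: left_chips_def right_chips_def rev_map map_map comp_def label_swap)
  then show ?thesis by (simp only: label_swap) (simp add: add.commute)
qed

lemma outcome_swap':
  "settle_swap (int r) (map int (left_chips n \<pi> (r + 1))) (int (r + 1)) (int (label \<pi> (r + 1) (center n)))
     (map int (right_chips n \<pi> (r + 1))) = outcome_int n \<pi> r"
proof -
  have "swap (int r) (int (label \<pi> (r + 1) j)) = int (label \<pi> r j)" for j
    unfolding label_swap[symmetric] by simp
  then have "map (swap (int r)) (map int (left_chips n \<pi> (r + 1))) = map int (left_chips n \<pi> r)"
    "map (swap (int r)) (map int (right_chips n \<pi> (r + 1))) = map int (right_chips n \<pi> r)"
    "swap (int r) (int (label \<pi> (r + 1) (center n))) = int (label \<pi> r (center n))"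
    by (simp_all only: left_chips_def right_chips_def rev_map map_map comp_def)
  moreover have "swap (int r) (int (r + 1)) = int r" by (simp add: transpose_def)
  ultimately show ?thesis by (simp only:)
qed

lemma set_int_chips:
  assumes "n \<ge> 1" "\<pi> permutes {1..n}" "1 \<le> r" "r \<le> n + 1"
  shows "set (map int (left_chips n \<pi> r) @ int r # int (label \<pi> r (center n)) #
      map int (right_chips n \<pi> r)) = {1..int n + 1}" (is "?S = _")
proof -
  have "?S = int ` set (left_chips n \<pi> r @ r # label \<pi> r (center n) # right_chips n \<pi> r)"
    by auto
  then have "?S = int ` {1..n + 1}" unfolding set_chips[OF assms] .
  then show ?thesis by (simp add: image_int_atLeastAtMost)
qed

lemma distinct_int_chips:
  assumes "n \<ge> 1" "\<pi> permutes {1..n}" "1 \<le> r" "r \<le> n + 1"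
  shows "distinct (map int (left_chips n \<pi> r) @ int r # int (label \<pi> r (center n)) #
      map int (right_chips n \<pi> r))"
proof -
  have "distinct (map int (left_chips n \<pi> r @ r # label \<pi> r (center n) # right_chips n \<pi> r))"
    using distinct_chips[OF assms] by (simp only: distinct_map inj_on_of_nat simp_thms)
  then show ?thesis by simp
qed

section \<open>Passing between consecutive values of \<open>r\<close>\<close>

text \<open>In the process for \<open>r + 1\<close> the larger chip of the pair is at the origin.
  Exactly \<open>r\<close> labels are below it, and \<open>n - center n\<close> chips start on the
  right.\<close>

lemma toppleable_pred:
  assumes "n \<ge> 1" "\<pi> permutes {1..n}" "1 \<le> r" "r + center n \<le> n"
    and "toppleable n (r + 1) \<pi>"
  shows "toppleable n r \<pi>"
proof -
  have c: "1 \<le> center n" "center n \<le> n" using assms(1) by auto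
  have r: "1 \<le> r + 1" "r + 1 \<le> n + 1" "r \<le> n + 1" using assms(4) by auto
  let ?L = "map int (left_chips n \<pi> (r + 1))" and ?R = "map int (right_chips n \<pi> (r + 1))"
    and ?v = "int (label \<pi> (r + 1) (center n))"
  have S: "set (?L @ (int r + 1) # ?v # ?R) = {1..int n + 1}"
    using set_int_chips[OF assms(1,2) r(1,2)] by (simp add: add.commute)
  have d: "distinct (?L @ (int r + 1) # ?v # ?R)"
    using distinct_int_chips[OF assms(1,2) r(1,2)] by (simp add: add.commute)
  have s: "sorted (settle ?L (int r + 1) ?v ?R)"
    using assms(5) toppleable_iff_sorted_int[OF assms(1,2) r(1,2)] by (simp add: add.commute)
  have len: "length ?L = center n - 1" "length ?R = n - center n"
    using length_chips by simp_all
  have "int r \<in> set (?L @ (int r + 1) # ?v # ?R)" unfolding S using assms(3) r by auto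
  then have "int r \<in> set (?L @ ?v # ?R)" by auto
  moreover have "length ?L \<le> length ?R + 1" "length ?R \<le> length ?L + 1" unfolding len by auto
  moreover have "card {x \<in> set (?L @ (int r + 1) # ?v # ?R). x < int r + 1} \<le> length ?R"
  proof -
    have "{x \<in> {1..int n + 1}. x < int r + 1} = {1..int r}" using r by auto
    then show ?thesis unfolding S len using assms(4) by simp
  qed
  ultimately have "settle_swap (int r) ?L (int r + 1) ?v ?R = settle ?L (int r + 1) ?v ?R"
    using settle_swap_origin_upper[OF d s] by blast
  then have "outcome_int n \<pi> r = settle ?L (int r + 1) ?v ?R"
    using outcome_swap'[of r n \<pi>] by (simp add: add.commute)
  then show ?thesis using s toppleable_iff_sorted_int[OF assms(1,2,3) r(3)] by simp
qed

text \<open>In the process for \<open>r\<close> the smaller chip of the pair is at the origin.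
  Exactly \<open>n + 1 - r\<close> labels are above it, and \<open>center n - 1\<close> chips start
  on the left.\<close>

lemma toppleable_Suc:
  assumes "n \<ge> 1" "\<pi> permutes {1..n}" "r \<le> n" "n + 2 \<le> r + center n"
    and "toppleable n r \<pi>"
  shows "toppleable n (r + 1) \<pi>"
proof -
  have c: "1 \<le> center n" "center n \<le> n" using assms(1) by auto
  have r: "1 \<le> r" "r \<le> n + 1" "1 \<le> r + 1" "r + 1 \<le> n + 1" using assms(3,4) c by auto
  let ?L = "map int (left_chips n \<pi> r)" and ?R = "map int (right_chips n \<pi> r)"
    and ?v = "int (label \<pi> r (center n))"
  have S: "set (?L @ int r # ?v # ?R) = {1..int n + 1}"
    using set_int_chips[OF assms(1,2) r(1,2)] .
  have d: "distinct (?L @ int r # ?v # ?R)"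
    by (rule distinct_int_chips[OF assms(1,2) r(1,2)])
  have s: "sorted (settle ?L (int r) ?v ?R)"
    using assms(5) toppleable_iff_sorted_int[OF assms(1,2) r(1,2)] by simp
  have len: "length ?L = center n - 1" "length ?R = n - center n"
    using length_chips by simp_all
  have "int r + 1 \<in> set (?L @ int r # ?v # ?R)" unfolding S using assms(3) by auto
  then have "int r + 1 \<in> set (?L @ ?v # ?R)" by auto
  moreover have "length ?L \<le> length ?R + 1" "length ?R \<le> length ?L + 1" unfolding len by auto
  moreover have "card {x \<in> set (?L @ int r # ?v # ?R). x > int r} \<le> length ?L"
  proof -
    have "{x \<in> {1..int n + 1}. x > int r} = {int r + 1..int n + 1}" using r by auto
    then show ?thesis unfolding S len using assms(3,4) by simp
  qed
  ultimately have "settle_swap (int r) ?L (int r) ?v ?R = settle ?L (int r) ?v ?R"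
    using settle_swap_origin_lower[OF d s] by blast
  then have "outcome_int n \<pi> (r + 1) = settle ?L (int r) ?v ?R"
    using outcome_swap[of r n \<pi>] by simp
  then show ?thesis using s toppleable_iff_sorted_int[OF assms(1,2) r(3,4)] by simp
qed

text \<open>The \<open>r - 1\<close> labels below \<open>r\<close> are as many as the chips starting
  on the right, so \<open>r\<close> and \<open>r + 1\<close> are the median pair.\<close>

lemma toppleable_median:
  assumes "n \<ge> 1" "\<pi> permutes {1..n}" "r = n - center n + 1"
  shows "toppleable n r \<pi> \<longleftrightarrow> toppleable n (r + 1) \<pi>"
proof -
  have c: "1 \<le> center n" "center n \<le> n" using assms(1) by auto
  have r: "1 \<le> r" "r \<le> n + 1" "1 \<le> r + 1" "r + 1 \<le> n + 1" using assms(3) c by auto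
  \<comment> \<open>Taking \<open>s\<close> as \<open>r\<close> or \<open>r + 1\<close> serves both
    implications, since the pair is the same in the two processes.\<close>
  have med: "settle_swap (int r) L u v R = settle L u v R"
    if "L = map int (left_chips n \<pi> s)" "R = map int (right_chips n \<pi> s)" "u = int s"
      "v = int (label \<pi> s (center n))" "s = r \<or> s = r + 1" "sorted (settle L u v R)" for s L u v R
  proof (rule settle_swap_median)
    have s: "1 \<le> s" "s \<le> n + 1" using that(5) r by auto
    have S: "set (L @ u # v # R) = {1..int n + 1}"
      using set_int_chips[OF assms(1,2) s] unfolding that(1-4) .
    show "distinct (L @ u # v # R)"
      using distinct_int_chips[OF assms(1,2) s] unfolding that(1-4) .
    show "sorted (settle L u v R)" by fact
    show "int r \<in> set (L @ u # v # R)" "int r + 1 \<in> set (L @ u # v # R)"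
      unfolding S using r by auto
    have len: "length L = center n - 1" "length R = n - center n"
      using length_chips unfolding that(1,2) by simp_all
    show "length R = length L \<or> length R = length L + 1" unfolding len using c by auto
    have "{x \<in> {1..int n + 1}. x < int r} = {1..int r - 1}" using r by auto
    then show "card {x \<in> set (L @ u # v # R). x < int r} = length R"
      unfolding S len using assms(3) by simp
  qed
  have "outcome_int n \<pi> (r + 1) = outcome_int n \<pi> r" if "sorted (outcome_int n \<pi> r)"
    using med[OF refl refl refl refl _ that] outcome_swap[of r n \<pi>] by simp
  moreover have "outcome_int n \<pi> r = outcome_int n \<pi> (r + 1)" if "sorted (outcome_int n \<pi> (r + 1))"
    using med[OF refl refl refl refl _ that] outcome_swap'[of r n \<pi>] by simp
  ultimately show ?thesis
    using toppleable_iff_sorted_int[OF assms(1,2) r(1,2)] toppleable_iff_sorted_int[OF assms(1,2) r(3,4)]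
    by metis
qed

theorem theorem3p1:
  fixes m :: nat
  assumes "m \<ge> 1"
  shows "(\<forall>n \<pi>. n = 2 * m + 1 \<and> \<pi> permutes {1..n} \<longrightarrow>
            (\<forall>r. 2 \<le> r \<and> r \<le> m + 1 \<and> toppleable n r \<pi> \<longrightarrow> toppleable n (r - 1) \<pi>) \<and>
            (\<forall>r. m + 2 \<le> r \<and> r \<le> 2 * m \<and> toppleable n r \<pi> \<longrightarrow> toppleable n (r + 1) \<pi>) \<and>
            (toppleable n (m + 1) \<pi> \<longleftrightarrow> toppleable n (m + 2) \<pi>)) \<and>
         (\<forall>n \<pi>. n = 2 * m \<and> \<pi> permutes {1..n} \<longrightarrow>
            (\<forall>r. 2 \<le> r \<and> r \<le> m + 1 \<and> toppleable n r \<pi> \<longrightarrow> toppleable n (r - 1) \<pi>) \<and>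
            (\<forall>r. m + 2 \<le> r \<and> r \<le> n \<and> toppleable n r \<pi> \<longrightarrow> toppleable n (r + 1) \<pi>) \<and>
            (toppleable n (m + 1) \<pi> \<longleftrightarrow> toppleable n (m + 2) \<pi>))"
proof -
  have *: "(\<forall>r. 2 \<le> r \<and> r \<le> m + 1 \<and> toppleable n r \<pi> \<longrightarrow> toppleable n (r - 1) \<pi>) \<and>
     (\<forall>r. m + 2 \<le> r \<and> r \<le> n \<and> toppleable n r \<pi> \<longrightarrow> toppleable n (r + 1) \<pi>) \<and>
     (toppleable n (m + 1) \<pi> \<longleftrightarrow> toppleable n (m + 2) \<pi>)"
    if n: "n = 2 * m + 1 \<or> n = 2 * m" and \<pi>: "\<pi> permutes {1..n}" for n \<pi>
  proof (intro conjI allI impI; (elim conjE)?)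
    have n1: "n \<ge> 1" using n assms by auto
    \<comment> \<open>This holds for either parity, which is why the two cases share one
      argument.\<close>
    have c: "n - center n = m" "center n \<le> n" using n by auto
    {
      fix r assume "2 \<le> r" "r \<le> m + 1" "toppleable n r \<pi>"
      then show "toppleable n (r - 1) \<pi>"
        using toppleable_pred[OF n1 \<pi>, of "r - 1"] c by simp
    next
      fix r assume "m + 2 \<le> r" "r \<le> n" "toppleable n r \<pi>"
      then show "toppleable n (r + 1) \<pi>"
        using toppleable_Suc[OF n1 \<pi>, of r] c by simp
    next
      show "toppleable n (m + 1) \<pi> \<longleftrightarrow> toppleable n (m + 2) \<pi>"
        using toppleable_median[OF n1 \<pi>, of "m + 1"] c by simp
    }
  qed
  show ?thesis
    by (intro conjI[OF allI[OF allI[OF impI]] allI[OF allI[OF impI]]]) (use * in \<open>auto; fail\<close>)+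
qed

end
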